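(* Let $X,Y$ be semi-rectifiable compact plane sets, let $\mathcal{F}$ be an effective collection of paths in $X$ and let $\mathcal{G}$ be an effective collection of paths in $Y$. Let $\varphi\in D_{\mathcal{F}}^{(\infty)}(X)$ be such that $\varphi(X)\subseteq Y$, $\varphi$ is $\mathcal{F}$-analytic, and $\varphi$ is $\mathcal{F}$-$\mathcal{G}$-compatible. Let $M=(M_n)_{n=0}^\infty$ be a non-analytic algebra sequence. (a) If $|\varphi^{[1]}|_X<1$ then $\varphi$ induces a homomorphism from $D_{\mathcal{G}}(Y,M)$ into $D_{\mathcal{F}}(X,M)$. (b) If the sequence $(n^2M_{n-1}/M_n)_{n\ge 1}$ is bounded and $|\varphi^{[1]}|_X\leq 1$ then $\varphi$ induces a homomorphism from $D_{\mathcal{G}}(Y,M)$ into $D_{\mathcal{F}}(X,M)$. Here "$\varphi$ induces a homomorphism" means that $f\circ\varphi\in D_{\mathcal{F}}(X,M)$ for every $f\in D_{\mathcal{G}}(Y,M)$, so that $f\mapsto f\circ\varphi$ is an algebra homomorphism from $D_{\mathcal{G}}(Y,M)$ into $D_{\mathcal{F}}(X,M)$.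
   Context: A compact plane set is a non-empty compact subset of $\mathbb{C}$. $C(X)$ is the algebra of continuous complex-valued functions on $X$, and $|f|_X=\sup_{x\in X}|f(x)|$. Paths: A path is a continuous map $\gamma:[a,b]\to\mathbb{C}$ with $a<b$ real; $\gamma^-=\gamma(a)$, $\gamma^+=\gamma(b)$, and $\gamma^*=\gamma([a,b])$; $\gamma$ is a path in $X$ if $\gamma^*\subseteq X$. A subpath of $\gamma$ is a restriction of $\gamma$ to a non-degenerate closed subinterval of $[a,b]$. $\gamma$ is rectifiable if its total variation is finite, and then its length $\Lambda(\gamma)$ is $V_a^b(\gamma)$, where $V_c^d(\gamma)$ is the total variation of $\gamma$ over $[c,d]$. $\gamma$ is a Jordan path if it is injective. $\gamma$ is admissible if it is rectifiable and has no constant subpaths. For a non-constant rectifiable path $\gamma$, the path length parametrisation $\gamma^{\mathrm{pl}}:[0,\Lambda(\gamma)]\to\mathbb{C}$ is the unique path with $\gamma^{\mathrm{pl}}(V_a^t(\gamma))=\gamma(t)$ for all $t\in[a,b]$. Integrals $\int_\gamma f(z)\,dz$ along rectifiable paths are Riemann–Stieltjes integrals. A compact plane set $X$ is semi-rectifiable if the union of the images of all rectifiable Jordan paths in $X$ is dense in $X$. A collection $\mathcal{F}$ of paths in $X$ is effective if $\bigcup_{\gamma\in\mathcal{F}}\gamma^*$ is dense in $X$, each path in $\mathcal{F}$ is admissible, and every subpath of a path in $\mathcal{F}$ belongs to $\mathcal{F}$. $\mathcal{F}$-derivatives: For $f\in C(X)$, a function $g\in C(X)$ is an $\mathcal{F}$-derivative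 of $f$ if $\int_\gamma g(z)\,dz=f(\gamma^+)-f(\gamma^-)$ for each $\gamma\in\mathcal{F}$; $f$ is $\mathcal{F}$-differentiable if it has an $\mathcal{F}$-derivative. When $X$ is semi-rectifiable and $\mathcal{F}$ is effective, the $\mathcal{F}$-derivative is unique and is denoted $f^{[1]}$; $D_{\mathcal{F}}^{(1)}(X)$ is the set of all $\mathcal{F}$-differentiable functions in $C(X)$. Inductively, for $n\geq 2$, $D_{\mathcal{F}}^{(n)}(X)=\{f\in D_{\mathcal{F}}^{(1)}(X): f^{[1]}\in D_{\mathcal{F}}^{(n-1)}(X)\}$, $f^{[n]}$ denotes the $n$th $\mathcal{F}$-derivative of $f$, $f^{[0]}=f$, and $D_{\mathcal{F}}^{(\infty)}(X)=\bigcap_{n=1}^\infty D_{\mathcal{F}}^{(n)}(X)$. A function $f\in D_{\mathcal{F}}^{(\infty)}(X)$ is $\mathcal{F}$-analytic if $\limsup_{k\to\infty}\left(|f^{[k]}|_X/k!\right)^{1/k}<\infty$. (Similarly for $\mathcal{G}$ and $Y$.) Compatibility: For an admissible path $\gamma$ in $Y$ and $f,g\in C(Y)$, $g$ is the $\gamma$-derivative of $f$ if $\int_\sigma g(z)\,dz=f(\sigma^+)-f(\sigma^-)$ for each subpath $\sigma$ of $\gamma$. $\mathfrak{m}(\mathcal{G})$ is the collection of all admissible paths $\gamma$ in $Y$ such that, for every $f\in D_{\mathcal{G}}^{(1)}(Y)$, $f^{[1]}$ is the $\gamma$-derivative of $f$. A function $\varphi\in D_{\mathcal{F}}^{(1)}(X)$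 with $\varphi(X)\subseteq Y$ is $\mathcal{F}$-$\mathcal{G}$-compatible if, for each $\gamma\in\mathcal{F}$, either $\varphi\circ\gamma$ is constant or $(\varphi\circ\gamma)^{\mathrm{pl}}\in\mathfrak{m}(\mathcal{G})$. Algebra sequences: A sequence $M=(M_n)_{n=0}^\infty$ of positive real numbers is an algebra sequence if $M_0=1$ and $\binom{j+k}{j}\leq M_{j+k}/(M_jM_k)$ for all non-negative integers $j,k$. It is non-analytic if $d(M):=\lim_{n\to\infty}(n!/M_n)^{1/n}=0$. For an algebra sequence $M$, \[ D_{\mathcal{F}}(X,M)=\Big\{f\in D_{\mathcal{F}}^{(\infty)}(X):\sum_{j=0}^\infty\frac{|f^{[j]}|_X}{M_j}<\infty\Big\}, \] an algebra under pointwise operations, with norm $\|f\|=\sum_{j=0}^\infty|f^{[j]}|_X/M_j$; $D_{\mathcal{G}}(Y,M)$ is defined in the same way. *)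

theory Defs
  imports "HOL-Analysis.Analysis"
begin

section \<open>Compact plane sets and continuous functions\<close>

definition compact_plane_set :: "complex set \<Rightarrow> bool" where
  "compact_plane_set X \<longleftrightarrow> compact X \<and> X \<noteq> {}"

text \<open>
  Functions with domain \<open>X\<close> are represented by their extensional representatives (they are
  \<open>undefined\<close> off \<open>X\<close>), so that HOL equality of members of \<open>Cont X\<close> is equality of functions
  on \<open>X\<close>.
\<close>

definition Cont :: "complex set \<Rightarrow> (complex \<Rightarrow> complex) set" where
  "Cont X = {f \<in> extensional X. continuous_on X f}"

definition sup_norm :: "complex set \<Rightarrow> (complex \<Rightarrow> complex) \<Rightarrow> real" where
  "sup_norm X f = (SUP x\<in>X. cmod (f x))"


section \<open>Paths\<close>

text \<open>
  A path carries its parameter interval \<open>[lo \<gamma>, hi \<gamma>]\<close>; its map is again extensional, so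
  equal paths are equal in HOL. (The constant \<^const>\<open>path\<close> of the library only covers the
  parameter interval \<open>[0, 1]\<close>, which is not enough for collections closed under subpaths or for
  path length parametrisations.)
\<close>

datatype plane_path = Plane_Path (lo: real) (hi: real) (pt: "real \<Rightarrow> complex")

definition is_path :: "plane_path \<Rightarrow> bool" where
  "is_path \<gamma> \<longleftrightarrow> lo \<gamma> < hi \<gamma> \<and> pt \<gamma> \<in> extensional {lo \<gamma>..hi \<gamma>}
     \<and> continuous_on {lo \<gamma>..hi \<gamma>} (pt \<gamma>)"

definition path_start :: "plane_path \<Rightarrow> complex" where
  "path_start \<gamma> = pt \<gamma> (lo \<gamma>)"

definition path_end :: "plane_path \<Rightarrow> complex" where
  "path_end \<gamma> = pt \<gamma> (hi \<gamma>)"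

definition path_trace :: "plane_path \<Rightarrow> complex set" where
  "path_trace \<gamma> = pt \<gamma> ` {lo \<gamma>..hi \<gamma>}"

definition path_in :: "complex set \<Rightarrow> plane_path \<Rightarrow> bool" where
  "path_in X \<gamma> \<longleftrightarrow> is_path \<gamma> \<and> path_trace \<gamma> \<subseteq> X"

definition is_subpath :: "plane_path \<Rightarrow> plane_path \<Rightarrow> bool" where
  "is_subpath \<sigma> \<gamma> \<longleftrightarrow>
     (\<exists>c d. lo \<gamma> \<le> c \<and> c < d \<and> d \<le> hi \<gamma> \<and> \<sigma> = Plane_Path c d (restrict (pt \<gamma>) {c..d}))"

definition constant_path :: "plane_path \<Rightarrow> bool" where
  "constant_path \<gamma> \<longleftrightarrow> (\<exists>z. \<forall>t\<in>{lo \<gamma>..hi \<gamma>}. pt \<gamma> t = z)"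

definition jordan_path :: "plane_path \<Rightarrow> bool" where
  "jordan_path \<gamma> \<longleftrightarrow> is_path \<gamma> \<and> inj_on (pt \<gamma>) {lo \<gamma>..hi \<gamma>}"

text \<open>The polygonal sums over all divisions of \<open>[c, d]\<close>, whose supremum is the variation.\<close>

definition variation_sums :: "(real \<Rightarrow> complex) \<Rightarrow> real \<Rightarrow> real \<Rightarrow> real set" where
  "variation_sums p c d = {(\<Sum>K\<in>\<D>. cmod (p (Sup K) - p (Inf K))) | \<D>. \<D> division_of {c..d}}"

definition path_variation :: "plane_path \<Rightarrow> real \<Rightarrow> real \<Rightarrow> real" where
  "path_variation \<gamma> c d = Sup (variation_sums (pt \<gamma>) c d)"

definition rectifiable :: "plane_path \<Rightarrow> bool" where
  "rectifiable \<gamma> \<longleftrightarrow> is_path \<gamma> \<and> bdd_above (variation_sums (pt \<gamma>) (lo \<gamma>) (hi \<gamma>))"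

definition path_len :: "plane_path \<Rightarrow> real" where
  "path_len \<gamma> = path_variation \<gamma> (lo \<gamma>) (hi \<gamma>)"

definition admissible :: "plane_path \<Rightarrow> bool" where
  "admissible \<gamma> \<longleftrightarrow> rectifiable \<gamma> \<and> (\<forall>\<sigma>. is_subpath \<sigma> \<gamma> \<longrightarrow> \<not> constant_path \<sigma>)"

text \<open>Only meaningful for non-constant rectifiable \<open>\<gamma>\<close>.\<close>

definition path_length_param :: "plane_path \<Rightarrow> plane_path" where
  "path_length_param \<gamma> =
     (THE \<eta>. is_path \<eta> \<and> lo \<eta> = 0 \<and> hi \<eta> = path_len \<gamma>
        \<and> (\<forall>t\<in>{lo \<gamma>..hi \<gamma>}. pt \<eta> (path_variation \<gamma> (lo \<gamma>) t) = pt \<gamma> t))"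

definition path_compose :: "(complex \<Rightarrow> complex) \<Rightarrow> plane_path \<Rightarrow> plane_path" where
  "path_compose \<phi> \<gamma> = Plane_Path (lo \<gamma>) (hi \<gamma>) (compose {lo \<gamma>..hi \<gamma>} \<phi> (pt \<gamma>))"

text \<open>
  \<open>has_path_integral f \<gamma> I\<close>: the Riemann--Stieltjes integral of \<open>f \<circ> \<gamma>\<close> with respect to \<open>\<gamma>\<close>
  exists and equals \<open>I\<close>, as the limit of Riemann--Stieltjes sums when the mesh tends to 0. For
  continuous \<open>f\<close> and rectifiable \<open>\<gamma>\<close> existence is automatic.
\<close>

definition has_path_integral :: "(complex \<Rightarrow> complex) \<Rightarrow> plane_path \<Rightarrow> complex \<Rightarrow> bool" where
  "has_path_integral f \<gamma> I \<longleftrightarrow>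
     (\<forall>\<epsilon>>0. \<exists>\<delta>>0. \<forall>\<D>. \<D> tagged_division_of {lo \<gamma>..hi \<gamma>} \<and> (\<forall>(t, K)\<in>\<D>. Sup K - Inf K < \<delta>)
        \<longrightarrow> cmod ((\<Sum>(t, K)\<in>\<D>. f (pt \<gamma> t) * (pt \<gamma> (Sup K) - pt \<gamma> (Inf K))) - I) < \<epsilon>)"

definition semi_rectifiable :: "complex set \<Rightarrow> bool" where
  "semi_rectifiable X \<longleftrightarrow>
     X \<subseteq> closure (\<Union> (path_trace ` {\<gamma>. path_in X \<gamma> \<and> rectifiable \<gamma> \<and> jordan_path \<gamma>}))"

definition effective :: "complex set \<Rightarrow> plane_path set \<Rightarrow> bool" where
  "effective X \<F> \<longleftrightarrow>
     (\<forall>\<gamma>\<in>\<F>. path_in X \<gamma>) \<and> X \<subseteq> closure (\<Union> (path_trace ` \<F>))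
     \<and> (\<forall>\<gamma>\<in>\<F>. admissible \<gamma>) \<and> (\<forall>\<gamma>\<in>\<F>. \<forall>\<sigma>. is_subpath \<sigma> \<gamma> \<longrightarrow> \<sigma> \<in> \<F>)"


section \<open>Derivatives with respect to a collection of paths\<close>

definition is_F_derivative ::
  "complex set \<Rightarrow> plane_path set \<Rightarrow> (complex \<Rightarrow> complex) \<Rightarrow> (complex \<Rightarrow> complex) \<Rightarrow> bool" where
  "is_F_derivative X \<F> f g \<longleftrightarrow> f \<in> Cont X \<and> g \<in> Cont X
     \<and> (\<forall>\<gamma>\<in>\<F>. has_path_integral g \<gamma> (f (path_end \<gamma>) - f (path_start \<gamma>)))"

definition F_differentiable ::
  "complex set \<Rightarrow> plane_path set \<Rightarrow> (complex \<Rightarrow> complex) set" where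
  "F_differentiable X \<F> = {f \<in> Cont X. \<exists>g. is_F_derivative X \<F> f g}"

text \<open>
  The description is proper when \<open>X\<close> is semi-rectifiable, \<open>\<F>\<close> is effective and \<open>f\<close> is
  \<open>\<F>\<close>-differentiable.
\<close>

definition F_deriv ::
  "complex set \<Rightarrow> plane_path set \<Rightarrow> (complex \<Rightarrow> complex) \<Rightarrow> (complex \<Rightarrow> complex)" where
  "F_deriv X \<F> f = (THE g. is_F_derivative X \<F> f g)"

definition F_higher_deriv ::
  "complex set \<Rightarrow> plane_path set \<Rightarrow> nat \<Rightarrow> (complex \<Rightarrow> complex) \<Rightarrow> (complex \<Rightarrow> complex)" where
  "F_higher_deriv X \<F> n = F_deriv X \<F> ^^ n"

text \<open>The value at order 0 is a convention that is not used below.\<close>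

fun Dn :: "complex set \<Rightarrow> plane_path set \<Rightarrow> nat \<Rightarrow> (complex \<Rightarrow> complex) set" where
  "Dn X \<F> 0 = Cont X"
| "Dn X \<F> (Suc 0) = F_differentiable X \<F>"
| "Dn X \<F> (Suc (Suc n)) = {f \<in> F_differentiable X \<F>. F_deriv X \<F> f \<in> Dn X \<F> (Suc n)}"

definition Dinf :: "complex set \<Rightarrow> plane_path set \<Rightarrow> (complex \<Rightarrow> complex) set" where
  "Dinf X \<F> = (\<Inter>n\<in>{1..}. Dn X \<F> n)"

definition F_analytic :: "complex set \<Rightarrow> plane_path set \<Rightarrow> (complex \<Rightarrow> complex) \<Rightarrow> bool" where
  "F_analytic X \<F> f \<longleftrightarrow> f \<in> Dinf X \<F>
     \<and> limsup (\<lambda>k. ereal (root k (sup_norm X (F_higher_deriv X \<F> k f) / fact k))) < \<infinity>"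


section \<open>Compatibility\<close>

definition path_derivative ::
  "complex set \<Rightarrow> plane_path \<Rightarrow> (complex \<Rightarrow> complex) \<Rightarrow> (complex \<Rightarrow> complex) \<Rightarrow> bool" where
  "path_derivative Y \<gamma> f g \<longleftrightarrow> f \<in> Cont Y \<and> g \<in> Cont Y
     \<and> (\<forall>\<sigma>. is_subpath \<sigma> \<gamma> \<longrightarrow> has_path_integral g \<sigma> (f (path_end \<sigma>) - f (path_start \<sigma>)))"

text \<open>The collection \<open>\<mm>(\<G>)\<close>.\<close>

definition maximal_paths :: "complex set \<Rightarrow> plane_path set \<Rightarrow> plane_path set" where
  "maximal_paths Y \<G> = {\<gamma>. path_in Y \<gamma> \<and> admissible \<gamma>
     \<and> (\<forall>f\<in>F_differentiable Y \<G>. path_derivative Y \<gamma> f (F_deriv Y \<G> f))}"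

definition compatible ::
  "complex set \<Rightarrow> plane_path set \<Rightarrow> complex set \<Rightarrow> plane_path set \<Rightarrow> (complex \<Rightarrow> complex) \<Rightarrow> bool"
where
  "compatible X \<F> Y \<G> \<phi> \<longleftrightarrow> \<phi> \<in> F_differentiable X \<F> \<and> \<phi> ` X \<subseteq> Y
     \<and> (\<forall>\<gamma>\<in>\<F>. constant_path (path_compose \<phi> \<gamma>)
              \<or> path_length_param (path_compose \<phi> \<gamma>) \<in> maximal_paths Y \<G>)"


section \<open>Algebra sequences and the algebras they define\<close>

definition algebra_sequence :: "(nat \<Rightarrow> real) \<Rightarrow> bool" where
  "algebra_sequence M \<longleftrightarrow> (\<forall>n. M n > 0) \<and> M 0 = 1
     \<and> (\<forall>j k. real ((j + k) choose j) \<le> M (j + k) / (M j * M k))"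

definition nonanalytic :: "(nat \<Rightarrow> real) \<Rightarrow> bool" where
  "nonanalytic M \<longleftrightarrow> (\<lambda>n. root n (fact n / M n)) \<longlonglongrightarrow> 0"

definition DM ::
  "complex set \<Rightarrow> plane_path set \<Rightarrow> (nat \<Rightarrow> real) \<Rightarrow> (complex \<Rightarrow> complex) set" where
  "DM X \<F> M = {f \<in> Dinf X \<F>. summable (\<lambda>j. sup_norm X (F_higher_deriv X \<F> j f) / M j)}"

text \<open>
  \<open>T\<close> maps the algebra \<open>A\<close> of functions on \<open>Y\<close> into the algebra \<open>B\<close> of functions on \<open>X\<close>,
  linearly and multiplicatively, for the pointwise operations on \<open>Y\<close> and on \<open>X\<close>.
\<close>

definition algebra_homomorphism ::
  "complex set \<Rightarrow> (complex \<Rightarrow> complex) set \<Rightarrow> complex set \<Rightarrow> (complex \<Rightarrow> complex) set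
     \<Rightarrow> ((complex \<Rightarrow> complex) \<Rightarrow> (complex \<Rightarrow> complex)) \<Rightarrow> bool" where
  "algebra_homomorphism Y A X B T \<longleftrightarrow>
     T \<in> A \<rightarrow> B
     \<and> (\<forall>f\<in>A. \<forall>g\<in>A. T (\<lambda>y\<in>Y. f y + g y) = (\<lambda>x\<in>X. T f x + T g x))
     \<and> (\<forall>c. \<forall>f\<in>A. T (\<lambda>y\<in>Y. c * f y) = (\<lambda>x\<in>X. c * T f x))
     \<and> (\<forall>f\<in>A. \<forall>g\<in>A. T (\<lambda>y\<in>Y. f y * g y) = (\<lambda>x\<in>X. T f x * T g x))"

definition induces_homomorphism ::
  "complex set \<Rightarrow> plane_path set \<Rightarrow> complex set \<Rightarrow> plane_path set \<Rightarrow> (nat \<Rightarrow> real)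
     \<Rightarrow> (complex \<Rightarrow> complex) \<Rightarrow> bool" where
  "induces_homomorphism X \<F> Y \<G> M \<phi> \<longleftrightarrow>
     algebra_homomorphism Y (DM Y \<G> M) X (DM X \<F> M) (\<lambda>f. compose X f \<phi>)"

end

theory Submission
  imports Defs
begin

text \<open>
  Fix \<open>f\<close> in the algebra on \<open>Y\<close>. Two things have to be shown: that \<open>f \<circ> \<phi>\<close> is infinitely
  differentiable with respect to \<open>\<F>\<close>, and that the weighted norms of its derivatives are summable.

  \<^emph>\<open>Differentiability.\<close> Let \<open>p\<close> be a rectifiable path. For continuous \<open>g\<close>, the
  integral of \<open>g\<close> over every subpath of \<open>p\<close> is the increment of \<open>f\<close> if and only if, for every
  \<open>\<epsilon> > 0\<close>, the modulus of \<open>f (p d) - f (p c) - g (p t) * (p d - p c)\<close> is at most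
  \<open>\<epsilon>\<close> times the variation of \<open>p\<close> over \<open>[c, d]\<close> for all \<open>c \<le> t \<le> d\<close> with
  \<open>d - c\<close> small (\<open>derivative_along\<close>). In this local form integrals disappear: the product rule and
  the chain rule are proved as for ordinary derivatives, and uniqueness holds because two derivatives
  that differ at a point would force the variation of \<open>p\<close> near that point to be at most half of
  itself, so that \<open>p\<close> would be constant there. Compatibility speaks about the path length
  parametrisation of \<open>\<phi> \<circ> \<gamma>\<close> for \<open>\<gamma> \<in> \<F>\<close>; this parametrisation is Lipschitz and the
  variation of a continuous function is continuous in its endpoints, so the local
  condition carries over to \<open>\<phi> \<circ> \<gamma>\<close> itself. Hence \<open>(f \<circ> \<phi>)' = (f' \<circ> \<phi>) \<phi>'\<close>
  (\<open>derivative_on_compose\<close>), and by the Leibniz rule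
  \<open>(f \<circ> \<phi>)\<^bsup>[n+1]\<^esup> = (\<Sum>k\<le>n. (n choose k) * (f' \<circ> \<phi>)\<^bsup>[k]\<^esup> * \<phi>\<^bsup>[n-k+1]\<^esup>)\<close> (\<open>comp_deriv\<close>).

  \<^emph>\<open>Summability.\<close> Put \<open>a\<^sub>k = |\<phi>\<^bsup>[k]\<^esup>|\<close>. The recursion above has a scalar counterpart, solved by the
  partial Bell polynomials \<open>B\<^bsub>n,i\<^esub> = n! / i! * [x^n] (x \<theta>(x))^i\<close> with
  \<open>\<theta>(x) = (\<Sum>m. a\<^bsub>m+1\<^esub> / (m+1)! * x^m)\<close>, so that
  \<open>|(f \<circ> \<phi>)\<^bsup>[n]\<^esup>| \<le> (\<Sum>i\<le>n. |f\<^bsup>[i]\<^esup>| * B\<^bsub>n,i\<^esub>)\<close> (\<open>comp_deriv_bound\<close>). It therefore suffices that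
  \<open>(\<Sum>n. B\<^bsub>n,i\<^esub> / M\<^sub>n) \<le> C / M\<^sub>i\<close> with \<open>C\<close> independent of \<open>i\<close>. If
  \<open>(i+m)! / i! * M\<^sub>i / M\<^bsub>i+m\<^esub> \<le> C * e^m\<close> for all \<open>m\<close>, the left side is at most \<open>C * \<theta>(e)^i / M\<^sub>i\<close>
  (\<open>bell_weighted_sum_le\<close>), and analyticity of \<open>\<phi>\<close> gives \<open>\<theta>(e) \<le> |\<phi>'| + O(e)\<close>.

  In case (a), the algebra inequality bounds the weight by \<open>m! / M\<^sub>m\<close>, which by nonanalyticity is at
  most \<open>C * e^m\<close> for any fixed \<open>e > 0\<close>; as \<open>|\<phi>'| < 1\<close>, a small \<open>e\<close> gives \<open>\<theta>(e) \<le> 1\<close>. In case (b),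
  iterating \<open>n\<^sup>2 M\<^bsub>n-1\<^esub> \<le> K M\<^sub>n\<close> bounds the weight by \<open>(K / (i+1))^m\<close>, so that \<open>e = K / (i+1)\<close> is allowed
  to depend on \<open>i\<close>, and \<open>\<theta>(e)^i \<le> (1 + O(1/i))^i\<close> stays bounded although \<open>|\<phi>'| = 1\<close> is possible.
\<close>

section \<open>Variation of a function on an interval\<close>

abbreviation variation :: "(real \<Rightarrow> complex) \<Rightarrow> real \<Rightarrow> real \<Rightarrow> real" where
  "variation p c d \<equiv> Sup (variation_sums p c d)"

definition bounded_variation :: "(real \<Rightarrow> complex) \<Rightarrow> real \<Rightarrow> real \<Rightarrow> bool" where
  "bounded_variation p a b \<longleftrightarrow> bdd_above (variation_sums p a b)"

lemma division_cellE:
  fixes a b :: real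
  assumes "\<D> division_of {a..b}" "K \<in> \<D>"
  obtains u v where "K = {u..v}" "u \<le> v" "a \<le> u" "v \<le> b" "Inf K = u" "Sup K = v"
proof -
  obtain u v where uv: "K = cbox u v" using assms by blast
  moreover have "K \<noteq> {}" "K \<subseteq> {a..b}" using assms by auto
  ultimately have "u \<le> v" "a \<le> u" "v \<le> b" by auto
  then show ?thesis using that[of u v] uv by simp
qed

lemma tagged_division_cellE:
  fixes a b :: real
  assumes "\<D> tagged_division_of {a..b}" "(t, K) \<in> \<D>"
  obtains u v where "K = {u..v}" "u \<le> t" "t \<le> v" "a \<le> u" "v \<le> b" "Inf K = u" "Sup K = v"
proof -
  have "t \<in> K" using assms by blast
  moreover have "snd ` \<D> division_of {a..b}" "K \<in> snd ` \<D>"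
    using assms division_of_tagged_division by force+
  ultimately obtain u v where "K = {u..v}" "a \<le> u" "v \<le> b" "Inf K = u" "Sup K = v"
    using division_cellE by metis
  with \<open>t \<in> K\<close> show ?thesis using that[of u v] by simp
qed

text \<open>
  Tagging each cell by its left endpoint makes a division a tagged one, so the telescoping identity for
  tagged divisions applies.
\<close>

lemma additive_division_1:
  fixes f :: "real \<Rightarrow> 'a::real_normed_vector"
  assumes "a \<le> b" and D: "\<D> division_of {a..b}"
  shows "(\<Sum>K\<in>\<D>. f (Sup K) - f (Inf K)) = f b - f a"
proof -
  let ?T = "(\<lambda>K. (Inf K, K)) ` \<D>"
  have "?T tagged_division_of {a..b}"
  proof (rule tagged_division_ofI)
    show "finite ?T" using D by auto
    fix x K assume "(x, K) \<in> ?T"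
    then have K: "K \<in> \<D>" and x: "x = Inf K" by auto
    show "x \<in> K" using division_cellE[OF D K] x by (metis atLeastAtMost_iff order_refl)
    show "K \<subseteq> {a..b}" "\<exists>u v. K = cbox u v" using D K by blast+
    fix x' K' assume "(x', K') \<in> ?T" "(x, K) \<noteq> (x', K')"
    then show "interior K \<inter> interior K' = {}" using D K x by (auto dest: division_ofD(5))
  next
    have "{K. \<exists>x. (x, K) \<in> ?T} = \<D>" by auto
    then show "\<Union> {K. \<exists>x. (x, K) \<in> ?T} = {a..b}" using division_ofD(6)[OF D] by simp
  qed
  from additive_tagged_division_1[OF assms(1) this, of f]
  show ?thesis by (subst (asm) sum.reindex) (auto simp: inj_on_def)
qed

text \<open>
  The variation is the least function of intervals that is additive and dominates all chords. Upper
  bounds for the variation are obtained by exhibiting a suitable \<open>w\<close>, without handling divisions.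
\<close>

lemma
  assumes "a \<le> b"
    and maj: "\<And>c d. a \<le> c \<Longrightarrow> c \<le> d \<Longrightarrow> d \<le> b \<Longrightarrow> cmod (p d - p c) \<le> w d - w c"
  shows bounded_variation_majorant: "bounded_variation p a b"
    and variation_le_majorant: "variation p a b \<le> w b - w a"
proof -
  have *: "s \<le> w b - w a" if "s \<in> variation_sums p a b" for s
  proof -
    from that obtain \<D> where D: "\<D> division_of {a..b}"
      and s: "s = (\<Sum>K\<in>\<D>. cmod (p (Sup K) - p (Inf K)))"
      unfolding variation_sums_def by blast
    have "s \<le> (\<Sum>K\<in>\<D>. w (Sup K) - w (Inf K))" unfolding s
      by (rule sum_mono) (metis division_cellE[OF D] maj)
    then show ?thesis using additive_division_1[OF assms(1) D, of w] by simp
  qed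
  then show "bounded_variation p a b" unfolding bounded_variation_def by (rule bdd_aboveI)
  have "{{a..b}} division_of {a..b}"
    using division_of_self[of a b] assms(1) by simp
  then have "variation_sums p a b \<noteq> {}" unfolding variation_sums_def by blast
  then show "variation p a b \<le> w b - w a" using * by (rule cSup_least)
qed

lemma chord_in_variation_sums:
  assumes "c \<le> d"
  shows "cmod (p d - p c) \<in> variation_sums p c d"
proof -
  have "{{c..d}} division_of {c..d}"
    using division_of_self[of c d] assms by simp
  moreover have "cmod (p d - p c) = (\<Sum>K\<in>{{c..d}}. cmod (p (Sup K) - p (Inf K)))"
    using assms by simp
  ultimately show ?thesis unfolding variation_sums_def by blast
qed

lemma variation_sums_concat:
  assumes "c \<le> x" "x \<le> d" "s \<in> variation_sums p c x" "s' \<in> variation_sums p x d"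
  shows "s + s' \<in> variation_sums p c d"
proof -
  obtain D where D: "D division_of {c..x}" "s = (\<Sum>K\<in>D. cmod (p (Sup K) - p (Inf K)))"
    using assms unfolding variation_sums_def by blast
  obtain D' where D': "D' division_of {x..d}" "s' = (\<Sum>K\<in>D'. cmod (p (Sup K) - p (Inf K)))"
    using assms unfolding variation_sums_def by blast
  have un: "{c..x} \<union> {x..d} = {c..d}" using assms by auto
  have "(D \<union> D') division_of {c..d}"
    using division_disjoint_union[OF D(1) D'(1)] un by (simp add: disjoint_iff)
  moreover have "(\<Sum>K\<in>D \<union> D'. cmod (p (Sup K) - p (Inf K))) = s + s'"
    unfolding D(2) D'(2)
  proof (rule sum.union_inter_neutral)
    show "finite D" "finite D'" using D D' by auto
    \<comment> \<open>A cell common to both divisions is the degenerate cell \<open>{x}\<close>.\<close>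
    show "\<forall>K\<in>D \<inter> D'. cmod (p (Sup K) - p (Inf K)) = 0"
    proof
      fix K assume K: "K \<in> D \<inter> D'"
      obtain u v where uv: "K = {u..v}" "u \<le> v" "v \<le> x" "Inf K = u" "Sup K = v"
        using K division_cellE[OF D(1), of K] by (metis IntD1)
      have "K \<subseteq> {x..d}" using K D'(1) by blast
      then have "u = v" using uv by auto
      then show "cmod (p (Sup K) - p (Inf K)) = 0" using uv by simp
    qed
  qed
  ultimately show ?thesis unfolding variation_sums_def by (metis (mono_tags, lifting) mem_Collect_eq)
qed

context
  fixes p :: "real \<Rightarrow> complex" and a b :: real
  assumes bv: "bounded_variation p a b"
begin

lemma bounded_variation_subinterval:
  assumes "a \<le> c" "c \<le> d" "d \<le> b"
  shows "bounded_variation p c d"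
proof -
  obtain B where B: "\<And>s. s \<in> variation_sums p a b \<Longrightarrow> s \<le> B"
    using bv unfolding bounded_variation_def bdd_above_def by blast
  have "s \<le> B" if "s \<in> variation_sums p c d" for s
  proof -
    have "cmod (p c - p a) + (s + cmod (p b - p d)) \<in> variation_sums p a b"
      using assms that by (intro variation_sums_concat[of a c b] variation_sums_concat[of c d b]
            chord_in_variation_sums) auto
    from B[OF this] show ?thesis
      using norm_ge_zero[of "p c - p a"] norm_ge_zero[of "p b - p d"] by linarith
  qed
  then show ?thesis unfolding bounded_variation_def by (rule bdd_aboveI)
qed

lemma variation_sum_le:
  assumes "a \<le> c" "c \<le> d" "d \<le> b" "s \<in> variation_sums p c d"
  shows "s \<le> variation p c d"
  using bounded_variation_subinterval[OF assms(1-3)] assms(4)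
  unfolding bounded_variation_def by (rule cSup_upper[rotated])

lemma chord_le_variation:
  assumes "a \<le> c" "c \<le> d" "d \<le> b"
  shows "cmod (p d - p c) \<le> variation p c d"
  using assms by (intro variation_sum_le chord_in_variation_sums)

lemma variation_nonneg:
  assumes "a \<le> c" "c \<le> d" "d \<le> b"
  shows "0 \<le> variation p c d"
  using chord_le_variation[OF assms] norm_ge_zero order_trans by blast

lemma variation_superadditive:
  assumes "a \<le> c" "c \<le> x" "x \<le> d" "d \<le> b"
  shows "variation p c x + variation p x d \<le> variation p c d"
proof -
  have "variation p c x \<le> variation p c d - s'" if s': "s' \<in> variation_sums p x d" for s'
  proof (rule cSup_least)
    show "variation_sums p c x \<noteq> {}" using chord_in_variation_sums assms by blast
    show "s \<le> variation p c d - s'" if "s \<in> variation_sums p c x" for s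
      using variation_sum_le[of c d "s + s'"] variation_sums_concat[OF _ _ that s'] assms by simp
  qed
  then have "s' \<le> variation p c d - variation p c x" if "s' \<in> variation_sums p x d" for s'
    using that by (simp add: algebra_simps)
  moreover have "variation_sums p x d \<noteq> {}" using chord_in_variation_sums assms by blast
  ultimately have "variation p x d \<le> variation p c d - variation p c x" by (rule cSup_least[rotated])
  then show ?thesis by simp
qed

text \<open>
  For the nontrivial inequality, gluing the variations over \<open>[c, y]\<close> and \<open>[x, y]\<close> at \<open>x\<close> gives an
  additive majorant of the chords.
\<close>

lemma variation_additive:
  assumes "a \<le> c" "c \<le> x" "x \<le> d" "d \<le> b"
  shows "variation p c d = variation p c x + variation p x d"
proof (rule antisym)
  define w where "w y = (if y \<le> x then variation p c y else variation p c x + variation p x y)" for y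
  have "variation p c d \<le> w d - w c"
  proof (rule variation_le_majorant)
    fix y z assume yz: "c \<le> y" "y \<le> z" "z \<le> d"
    consider "z \<le> x" | "x < y" | "y \<le> x" "x < z" by linarith
    then show "cmod (p z - p y) \<le> w z - w y"
    proof cases
      case 1
      then show ?thesis using yz assms chord_le_variation[of y z]
          variation_superadditive[of c y z] by (simp add: w_def)
    next
      case 2
      then show ?thesis using yz assms chord_le_variation[of y z]
          variation_superadditive[of x y z] by (simp add: w_def)
    next
      case 3
      have "cmod (p z - p y) \<le> cmod (p x - p y) + cmod (p z - p x)"
        using norm_triangle_ineq[of "p x - p y" "p z - p x"] by simp
      also have "\<dots> \<le> variation p y x + variation p x z"
        using 3 yz assms by (intro add_mono chord_le_variation) auto
      also have "\<dots> \<le> w z - w y"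
        using 3 yz assms variation_superadditive[of c y x] by (simp add: w_def)
      finally show ?thesis .
    qed
  qed (use assms in auto)
  also have "w c \<ge> 0" using variation_nonneg[of c c] assms by (simp add: w_def)
  then have "w d - w c \<le> variation p c x + variation p x d"
    using assms variation_nonneg[of x x] by (cases "d = x") (auto simp: w_def)
  finally show "variation p c d \<le> variation p c x + variation p x d" .
qed (rule variation_superadditive[OF assms])

lemma variation_refl:
  assumes "a \<le> c" "c \<le> b"
  shows "variation p c c = 0"
  using variation_additive[of c c c] assms by simp

lemma variation_diff:
  assumes "a \<le> c" "c \<le> d" "d \<le> b"
  shows "variation p c d = variation p a d - variation p a c"
  using variation_additive[of a c d] assms by simp

lemma variation_mono:
  assumes "a \<le> c" "c \<le> d" "d \<le> b"
  shows "variation p a c \<le> variation p a d"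
  using variation_diff[OF assms] variation_nonneg[OF assms] by simp

end

lemma variation_cong:
  assumes "c \<le> d" "\<And>t. c \<le> t \<Longrightarrow> t \<le> d \<Longrightarrow> p t = q t"
  shows "variation_sums p c d = variation_sums q c d"
proof -
  have "(\<Sum>K\<in>D. cmod (p (Sup K) - p (Inf K))) = (\<Sum>K\<in>D. cmod (q (Sup K) - q (Inf K)))"
    if "D division_of {c..d}" for D
  proof (rule sum.cong)
    fix K assume "K \<in> D"
    from division_cellE[OF that this] show "cmod (p (Sup K) - p (Inf K)) = cmod (q (Sup K) - q (Inf K))"
      using assms by (metis order_trans)
  qed simp
  then show ?thesis unfolding variation_sums_def by (intro Collect_cong) metis
qed

text \<open>
  A division \<open>D\<close> of \<open>[a, t]\<close> whose sum nearly exhausts the variation has only finitely many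
  division points, so \<open>s < t\<close> can be chosen beyond all of them. Splitting the last cell at \<open>s\<close> then
  costs only the chord from \<open>s\<close> to \<open>t\<close>, which is small by continuity; so nearly all of the variation
  over \<open>[a, t]\<close> lies in \<open>[a, s]\<close>.
\<close>

lemma variation_left_approx:
  assumes bv: "bounded_variation p a b" and cont: "continuous_on {a..b} p"
    and t: "a < t" "t \<le> b" and e: "e > 0"
  shows "\<exists>s0<t. \<forall>s. s0 < s \<and> s < t \<and> a \<le> s \<longrightarrow> variation p s t < e"
proof -
  have ne: "variation_sums p a t \<noteq> {}" using chord_in_variation_sums t by (metis empty_iff less_imp_le)
  obtain S where S: "S \<in> variation_sums p a t" "S > variation p a t - e/2"
    using less_cSupE[OF _ ne, of "variation p a t - e/2"] e by auto
  then obtain D where D: "D division_of {a..t}" and SD: "S = (\<Sum>K\<in>D. cmod (p (Sup K) - p (Inf K)))"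
    unfolding variation_sums_def by blast
  obtain r where r: "r > 0" "\<And>s. s \<in> {a..b} \<Longrightarrow> dist s t < r \<Longrightarrow> dist (p s) (p t) < e/2"
    using cont t e unfolding continuous_on_iff by (metis atLeastAtMost_iff half_gt_zero less_imp_le)
  \<comment> \<open>The point \<open>t - r\<close> forces \<open>s\<close> into the range where \<open>p s\<close> is close to \<open>p t\<close>.\<close>
  define E where "E = {x \<in> Inf ` D \<union> Sup ` D. x < t} \<union> {a, t - r}"
  have finE: "finite E" "E \<noteq> {}" using D unfolding E_def by auto
  define s0 where "s0 = Max E"
  have "s0 < t" unfolding s0_def using finE r(1) t by (subst Max_less_iff) (auto simp: E_def)
  moreover have "variation p s t < e" if s: "s0 < s" "s < t" "a \<le> s" for s
  proof -
    have Es: "x < s" if "x \<in> E" for x using that finE s(1) Max_ge unfolding s0_def by (metis order_le_less_trans)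
    \<comment> \<open>\<open>w\<close> majorises only the chords over cells of \<open>D\<close>: no cell has an endpoint in \<open>[s, t)\<close>.\<close>
    define w where "w x = (if x < t then variation p a x else variation p a s + cmod (p t - p s))" for x
    have "S \<le> (\<Sum>K\<in>D. w (Sup K) - w (Inf K))" unfolding SD
    proof (rule sum_mono)
      fix K assume K: "K \<in> D"
      obtain u v where uv: "u \<le> v" "a \<le> u" "v \<le> t" "Inf K = u" "Sup K = v"
        using division_cellE[OF D K] by metis
      consider "v < t" | "u = t" "v = t" | "v = t" "u < t" using uv by linarith
      then have "cmod (p v - p u) \<le> w v - w u"
      proof cases
        case 1
        then show ?thesis using uv t chord_le_variation[OF bv, of u v] variation_diff[OF bv, of u v]
          by (simp add: w_def)
      next
        case 3
        then have "u < s" using Es[of u] uv K by (force simp: E_def)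
        have "cmod (p v - p u) \<le> cmod (p t - p s) + cmod (p s - p u)"
          using norm_triangle_ineq[of "p t - p s" "p s - p u"] 3 by simp
        also have "\<dots> \<le> cmod (p t - p s) + variation p u s"
          using uv s t \<open>u < s\<close> by (intro add_mono chord_le_variation[OF bv]) auto
        also have "\<dots> = w v - w u"
          using variation_diff[OF bv, of u s] uv s t \<open>u < s\<close> 3 by (simp add: w_def)
        finally show ?thesis .
      qed auto
      then show "cmod (p (Sup K) - p (Inf K)) \<le> w (Sup K) - w (Inf K)" using uv by simp
    qed
    also have "\<dots> = w t - w a" using additive_division_1[OF _ D, of w] t by simp
    also have "\<dots> = variation p a s + cmod (p t - p s)"
      using t variation_refl[OF bv, of a] by (simp add: w_def)
    also have "dist s t < r" using s Es[of "t - r"] by (simp add: E_def dist_real_def)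
    then have "cmod (p t - p s) < e/2" using r(2)[of s] s t by (simp add: dist_norm norm_minus_commute)
    finally have "variation p a t - variation p a s < e" using S(2) by linarith
    then show ?thesis using variation_diff[OF bv, of s t] s t by simp
  qed
  ultimately show ?thesis by blast
qed

text \<open>
  Reversing the parameter reduces right limits of the variation to left limits.
\<close>

lemma variation_sums_reverse:
  "variation_sums (\<lambda>t. p (- t)) (- d) (- c) = variation_sums p c d"
proof -
  have sub: "variation_sums p c d \<subseteq> variation_sums (\<lambda>t. p (- t)) (- d) (- c)" for p c d
  proof
    fix s assume "s \<in> variation_sums p c d"
    then obtain D where D: "D division_of {c..d}" and s: "s = (\<Sum>K\<in>D. cmod (p (Sup K) - p (Inf K)))"
      unfolding variation_sums_def by blast
    let ?D = "(\<lambda>K. uminus ` K) ` D"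
    have inj: "inj_on (\<lambda>K. uminus ` K) D" for D :: "real set set"
      by (auto simp: inj_on_def inj_image_eq_iff)
    have "?D division_of {-d..-c}"
    proof (rule division_ofI)
      show "finite ?D" using D by auto
      show "\<Union> ?D = {-d..-c}"
        using division_ofD(6)[OF D] by (simp flip: image_Union)
      fix K assume "K \<in> ?D"
      then obtain L where L: "K = uminus ` L" "L \<in> D" by blast
      obtain u v where uv: "L = {u..v}" "u \<le> v" "c \<le> u" "v \<le> d"
        using division_cellE[OF D L(2)] by metis
      then have K: "K = {-v..-u}" using L by simp
      show "K \<subseteq> {-d..-c}" "K \<noteq> {}" using K uv by auto
      show "\<exists>a b. K = cbox a b" using K by (metis box_real(2))
      fix K' assume "K' \<in> ?D" "K \<noteq> K'"
      then obtain L' where L': "K' = uminus ` L'" "L' \<in> D" "L \<noteq> L'" using L by blast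
      have "interior L \<inter> interior L' = {}" using D L L' by blast
      then show "interior K \<inter> interior K' = {}"
        unfolding L L' interior_negations by (metis image_Int image_is_empty inj_uminus)
    qed
    moreover have "s = (\<Sum>K\<in>?D. cmod (p (- Sup K) - p (- Inf K)))"
      unfolding s
    proof (subst sum.reindex[OF inj], rule sum.cong)
      fix K assume K: "K \<in> D"
      obtain u v where "K = {u..v}" "u \<le> v" using division_cellE[OF D K] by metis
      then show "cmod (p (Sup K) - p (Inf K)) = ((\<lambda>K. cmod (p (- Sup K) - p (- Inf K))) \<circ> (`) uminus) K"
        by (simp add: norm_minus_commute)
    qed simp
    ultimately show "s \<in> variation_sums (\<lambda>t. p (- t)) (- d) (- c)"
      unfolding variation_sums_def by blast
  qed
  from sub[of p c d] sub[of "\<lambda>t. p (-t)" "-d" "-c"] show ?thesis by auto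
qed

lemma variation_right_approx:
  assumes bv: "bounded_variation p a b" and cont: "continuous_on {a..b} p"
    and t: "a \<le> t" "t < b" and e: "e > 0"
  shows "\<exists>s0>t. \<forall>s. t < s \<and> s < s0 \<and> s \<le> b \<longrightarrow> variation p t s < e"
proof -
  have "continuous_on {-b..-a} (\<lambda>t. p (- t))"
    by (rule continuous_on_compose2[OF cont]) (auto intro: continuous_intros)
  moreover have "bounded_variation (\<lambda>t. p (- t)) (-b) (-a)"
    using bv unfolding bounded_variation_def variation_sums_reverse .
  ultimately obtain s0 where s0: "s0 < -t"
    "\<And>s. s0 < s \<and> s < -t \<and> -b \<le> s \<Longrightarrow> variation (\<lambda>t. p (- t)) s (-t) < e"
    using variation_left_approx[of "\<lambda>t. p (- t)" "-b" "-a" "-t" e] t e by auto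
  have "variation p t s < e" if "t < s" "s < - s0" "s \<le> b" for s
    using s0(2)[of "-s"] that variation_sums_reverse[of p s t] by simp
  then show ?thesis using s0(1) by (intro exI[of _ "-s0"]) auto
qed

text \<open>
  This is what makes the path length parametrisation exist: its parameter values fill the whole
  interval up to the length of the path.
\<close>

lemma continuous_variation:
  assumes bv: "bounded_variation p a b" and cont: "continuous_on {a..b} p"
  shows "continuous_on {a..b} (variation p a)"
  unfolding continuous_on_iff
proof (intro ballI allI impI)
  fix t e :: real assume t: "t \<in> {a..b}" and e: "e > 0"
  have "\<exists>l<t. \<forall>s. l < s \<and> s < t \<and> a \<le> s \<longrightarrow> variation p s t < e"
  proof (cases "a = t")
    case True
    then show ?thesis by (intro exI[of _ "t - 1"]) simp
  next
    case False
    then show ?thesis using variation_left_approx[OF bv cont _ _ e, of t] t by simp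
  qed
  then obtain l where l: "l < t" "\<And>s. l < s \<Longrightarrow> s < t \<Longrightarrow> a \<le> s \<Longrightarrow> variation p s t < e"
    by blast
  have "\<exists>r>t. \<forall>s. t < s \<and> s < r \<and> s \<le> b \<longrightarrow> variation p t s < e"
  proof (cases "t = b")
    case True
    then show ?thesis by (intro exI[of _ "t + 1"]) simp
  next
    case False
    then show ?thesis using variation_right_approx[OF bv cont _ _ e, of t] t by simp
  qed
  then obtain r where r: "t < r" "\<And>s. t < s \<Longrightarrow> s < r \<Longrightarrow> s \<le> b \<Longrightarrow> variation p t s < e"
    by blast
  have "dist (variation p a s) (variation p a t) < e" if s: "s \<in> {a..b}" "dist s t < min (t - l) (r - t)" for s
  proof (cases s t rule: linorder_cases)
    case less
    then show ?thesis using l(2)[of s] s t variation_diff[OF bv, of s t] variation_nonneg[OF bv, of s t]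
      by (auto simp: dist_real_def)
  next
    case greater
    then show ?thesis using r(2)[of s] s t variation_diff[OF bv, of t s] variation_nonneg[OF bv, of t s]
      by (auto simp: dist_real_def)
  qed (use e in auto)
  then show "\<exists>d>0. \<forall>s\<in>{a..b}. dist s t < d \<longrightarrow> dist (variation p a s) (variation p a t) < e"
    using l(1) r(1) by (intro exI[of _ "min (t - l) (r - t)"]) auto
qed


section \<open>Derivatives along a parametrised path\<close>

text \<open>
  The local form of "\<open>G\<close> integrates to \<open>F\<close> over every subpath of \<open>p\<close>". The error is measured by the
  variation of \<open>p\<close> rather than by \<open>\<bar>p d - p c\<bar>\<close>, because only the variation is additive, and because
  a rectifiable path may return to the same point. The tag \<open>t\<close> ranges over all of \<open>[c, d]\<close> to match
  Riemann--Stieltjes sums with arbitrary tags.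
\<close>

definition derivative_along ::
  "(real \<Rightarrow> complex) \<Rightarrow> real \<Rightarrow> real \<Rightarrow> (real \<Rightarrow> complex) \<Rightarrow> (real \<Rightarrow> complex) \<Rightarrow> bool" where
  "derivative_along p a b F G \<longleftrightarrow>
     (\<forall>e>0. \<exists>\<delta>>0. \<forall>c t d. a \<le> c \<and> c \<le> t \<and> t \<le> d \<and> d \<le> b \<and> d - c < \<delta> \<longrightarrow>
        cmod (F d - F c - G t * (p d - p c)) \<le> e * variation p c d)"

lemma derivative_alongD:
  assumes "derivative_along p a b F G" "e > 0"
  obtains \<delta> where "\<delta> > 0"
    "\<And>c t d. a \<le> c \<Longrightarrow> c \<le> t \<Longrightarrow> t \<le> d \<Longrightarrow> d \<le> b \<Longrightarrow> d - c < \<delta> \<Longrightarrow>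
       cmod (F d - F c - G t * (p d - p c)) \<le> e * variation p c d"
  using assms unfolding derivative_along_def by metis

lemma mesh_division_exists:
  fixes a b :: real
  assumes "\<delta> > 0"
  obtains \<D> where "\<D> tagged_division_of {a..b}" "\<forall>(t, K)\<in>\<D>. Sup K - Inf K < \<delta>"
proof -
  have "gauge (\<lambda>t::real. ball t (\<delta>/2))" using assms by (intro gauge_ball) simp
  then obtain \<D> where D: "\<D> tagged_division_of {a..b}" "(\<lambda>t. ball t (\<delta>/2)) fine \<D>"
    using fine_division_exists_real by blast
  have "Sup K - Inf K < \<delta>" if tK: "(t, K) \<in> \<D>" for t K
  proof -
    have "K \<subseteq> ball t (\<delta>/2)" using D(2) tK by blast
    moreover obtain u v where uv: "K = {u..v}" "u \<le> t" "t \<le> v" "Inf K = u" "Sup K = v"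
      using tagged_division_cellE[OF D(1) tK] by metis
    moreover from uv have "u \<in> K" "v \<in> K" by auto
    ultimately have "dist t u < \<delta>/2" "dist t v < \<delta>/2" unfolding subset_iff mem_ball by blast+
    then show ?thesis using uv by (simp add: dist_real_def)
  qed
  then show ?thesis using D(1) that by blast
qed

text \<open>
  Local estimates against the variation add up over a fine division, since the variation is additive.
\<close>

lemma derivative_along_sum_le:
  assumes bv: "bounded_variation p a b" and ab: "a \<le> b"
    and est: "\<And>c t d. a \<le> c \<Longrightarrow> c \<le> t \<Longrightarrow> t \<le> d \<Longrightarrow> d \<le> b \<Longrightarrow> d - c < \<delta> \<Longrightarrow>
       cmod (h c t d) \<le> e * variation p c d"
    and D: "\<D> tagged_division_of {a..b}" "\<forall>(t, K)\<in>\<D>. Sup K - Inf K < \<delta>"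
  shows "cmod (\<Sum>(t, K)\<in>\<D>. h (Inf K) t (Sup K)) \<le> e * variation p a b"
proof -
  have "cmod (\<Sum>(t, K)\<in>\<D>. h (Inf K) t (Sup K))
      \<le> (\<Sum>(t, K)\<in>\<D>. e * (variation p a (Sup K) - variation p a (Inf K)))"
  proof (rule sum_norm_le)
    fix x assume x: "x \<in> \<D>"
    obtain t K where tK: "x = (t, K)" by (cases x)
    obtain u v where uv: "u \<le> t" "t \<le> v" "a \<le> u" "v \<le> b" "Inf K = u" "Sup K = v"
      using tagged_division_cellE[OF D(1), of t K] x tK by metis
    have "cmod (h u t v) \<le> e * variation p u v"
      using est[of u t v] uv D(2) x tK by auto
    then show "cmod (case x of (t, K) \<Rightarrow> h (Inf K) t (Sup K))
        \<le> (case x of (t, K) \<Rightarrow> e * (variation p a (Sup K) - variation p a (Inf K)))"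
      using variation_diff[OF bv, of u v] uv by (simp add: tK)
  qed
  also have "\<dots> = e * (\<Sum>(t, K)\<in>\<D>. variation p a (Sup K) - variation p a (Inf K))"
    by (simp add: sum_distrib_left case_prod_unfold)
  also have "\<dots> = e * variation p a b"
    using additive_tagged_division_1[OF ab D(1), of "variation p a"] variation_refl[OF bv, of a] ab
    by simp
  finally show ?thesis .
qed

lemma derivative_along_cong:
  assumes "derivative_along p a b F G"
    and "\<And>t. t \<in> {a..b} \<Longrightarrow> p t = q t" "\<And>t. t \<in> {a..b} \<Longrightarrow> F t = F' t" "\<And>t. t \<in> {a..b} \<Longrightarrow> G t = G' t"
  shows "derivative_along q a b F' G'"
  unfolding derivative_along_def
proof (intro allI impI)
  fix e :: real assume "e > 0"
  from derivative_alongD[OF assms(1) this] obtain \<delta> where \<delta>: "\<delta> > 0"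
    "\<And>c t d. a \<le> c \<Longrightarrow> c \<le> t \<Longrightarrow> t \<le> d \<Longrightarrow> d \<le> b \<Longrightarrow> d - c < \<delta> \<Longrightarrow>
       cmod (F d - F c - G t * (p d - p c)) \<le> e * variation p c d" by blast
  have "cmod (F' d - F' c - G' t * (q d - q c)) \<le> e * variation q c d"
    if "a \<le> c" "c \<le> t" "t \<le> d" "d \<le> b" "d - c < \<delta>" for c t d
  proof -
    have "variation_sums p c d = variation_sums q c d"
      using that assms(2) by (intro variation_cong) auto
    then show ?thesis using \<delta>(2)[OF that] that assms(2-4)[of c] assms(2-4)[of d] assms(4)[of t] by simp
  qed
  then show "\<exists>\<delta>>0. \<forall>c t d. a \<le> c \<and> c \<le> t \<and> t \<le> d \<and> d \<le> b \<and> d - c < \<delta> \<longrightarrow>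
        cmod (F' d - F' c - G' t * (q d - q c)) \<le> e * variation q c d"
    using \<delta>(1) by blast
qed

text \<open>
  The increments of \<open>F\<close> telescope, so the local errors add up to the difference between a Riemann
  sum and \<open>F b - F a\<close>.
\<close>

lemma derivative_along_imp_integral:
  assumes bv: "bounded_variation p a b" and ab: "a \<le> b"
    and der: "derivative_along p a b F (\<lambda>t. g (p t))"
  shows "has_path_integral g (Plane_Path a b (restrict p {a..b})) (F b - F a)"
  unfolding has_path_integral_def plane_path.sel
proof (intro allI impI)
  fix e :: real assume e: "e > 0"
  define V where "V = variation p a b"
  have V: "V \<ge> 0" unfolding V_def using variation_nonneg[OF bv] ab by simp
  define e' where "e' = e / (V + 1)"
  have e': "e' > 0" "e' * V < e" using e V by (auto simp: e'_def field_simps)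
  obtain \<delta> where \<delta>: "\<delta> > 0"
    "\<And>c t d. a \<le> c \<Longrightarrow> c \<le> t \<Longrightarrow> t \<le> d \<Longrightarrow> d \<le> b \<Longrightarrow> d - c < \<delta> \<Longrightarrow>
       cmod (F d - F c - g (p t) * (p d - p c)) \<le> e' * variation p c d"
    using derivative_alongD[OF der e'(1)] by blast
  let ?q = "restrict p {a..b}"
  have "cmod ((\<Sum>(t, K)\<in>\<D>. g (?q t) * (?q (Sup K) - ?q (Inf K))) - (F b - F a)) < e"
    if D: "\<D> tagged_division_of {a..b}" "\<forall>(t, K)\<in>\<D>. Sup K - Inf K < \<delta>" for \<D>
  proof -
    have "(\<Sum>(t, K)\<in>\<D>. g (?q t) * (?q (Sup K) - ?q (Inf K)))
        = (\<Sum>(t, K)\<in>\<D>. g (p t) * (p (Sup K) - p (Inf K)))"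
    proof (rule sum.cong)
      fix x assume x: "x \<in> \<D>"
      obtain t K where tK: "x = (t, K)" by (cases x)
      obtain u v where uv: "u \<le> t" "t \<le> v" "a \<le> u" "v \<le> b" "Inf K = u" "Sup K = v"
        using tagged_division_cellE[OF D(1), of t K] x tK by metis
      then show "(case x of (t, K) \<Rightarrow> g (?q t) * (?q (Sup K) - ?q (Inf K)))
          = (case x of (t, K) \<Rightarrow> g (p t) * (p (Sup K) - p (Inf K)))" by (simp add: tK)
    qed simp
    then have "F b - F a - (\<Sum>(t, K)\<in>\<D>. g (?q t) * (?q (Sup K) - ?q (Inf K)))
        = (\<Sum>(t, K)\<in>\<D>. F (Sup K) - F (Inf K) - g (p t) * (p (Sup K) - p (Inf K)))"
      using additive_tagged_division_1[OF ab D(1), of F]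
      by (simp add: case_prod_unfold sum_subtractf)
    also have "cmod \<dots> \<le> e' * V" unfolding V_def
      by (rule derivative_along_sum_le[where h = "\<lambda>c t d. F d - F c - g (p t) * (p d - p c)",
            OF bv ab \<delta>(2) D])
    finally show ?thesis using e'(2) by (simp add: norm_minus_commute)
  qed
  then show "\<exists>\<delta>>0. \<forall>\<D>. \<D> tagged_division_of {a..b} \<and> (\<forall>(t, K)\<in>\<D>. Sup K - Inf K < \<delta>) \<longrightarrow>
      cmod ((\<Sum>(t, K)\<in>\<D>. g (?q t) * (?q (Sup K) - ?q (Inf K))) - (F b - F a)) < e"
    using \<delta>(1) by blast
qed

text \<open>
  On a short interval the integrand oscillates by at most \<open>\<epsilon>\<close>, so its integral differs from
  \<open>g (p t) * (p d - p c)\<close> by at most \<open>\<epsilon>\<close> times the variation.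
\<close>

lemma integrals_imp_derivative_along:
  assumes bv: "bounded_variation p a b"
    and cont: "continuous_on {a..b} (\<lambda>t. g (p t))"
    and int: "\<And>c d. a \<le> c \<Longrightarrow> c < d \<Longrightarrow> d \<le> b \<Longrightarrow>
      has_path_integral g (Plane_Path c d (restrict p {c..d})) (F d - F c)"
  shows "derivative_along p a b F (\<lambda>t. g (p t))"
  unfolding derivative_along_def
proof (intro allI impI)
  fix e :: real assume e: "e > 0"
  have "uniformly_continuous_on {a..b} (\<lambda>t. g (p t))"
    using cont by (simp add: compact_uniformly_continuous)
  then obtain \<delta> where \<delta>: "\<delta> > 0"
    "\<And>s t. s \<in> {a..b} \<Longrightarrow> t \<in> {a..b} \<Longrightarrow> dist s t < \<delta> \<Longrightarrow> dist (g (p s)) (g (p t)) < e"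
    unfolding uniformly_continuous_on_def using e by metis
  have "cmod (F d - F c - g (p t) * (p d - p c)) \<le> e * variation p c d"
    if t: "a \<le> c" "c \<le> t" "t \<le> d" "d \<le> b" "d - c < \<delta>" for c t d
  proof (cases "c = d")
    case True
    then show ?thesis using variation_refl[OF bv] t by simp
  next
    case False
    then have cd: "c < d" using t by simp
    let ?q = "restrict p {c..d}"
    have bv': "bounded_variation p c d" using bounded_variation_subinterval[OF bv] t cd by simp
    show ?thesis
    proof (rule field_le_epsilon)
      fix \<eta> :: real assume "\<eta> > 0"
      moreover have "has_path_integral g (Plane_Path c d ?q) (F d - F c)"
        using int[of c d] t cd by simp
      ultimately obtain r where r: "r > 0"
        "\<forall>\<D>. \<D> tagged_division_of {c..d} \<and> (\<forall>(t, K)\<in>\<D>. Sup K - Inf K < r) \<longrightarrow>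
        cmod ((\<Sum>(t, K)\<in>\<D>. g (?q t) * (?q (Sup K) - ?q (Inf K))) - (F d - F c)) < \<eta>"
        unfolding has_path_integral_def plane_path.sel by blast
      obtain \<D> where D: "\<D> tagged_division_of {c..d}" "\<forall>(t, K)\<in>\<D>. Sup K - Inf K < r"
        using mesh_division_exists[OF r(1)] by blast
      have "(\<Sum>(s, K)\<in>\<D>. g (?q s) * (?q (Sup K) - ?q (Inf K))) - g (p t) * (p d - p c)
          = (\<Sum>(s, K)\<in>\<D>. g (?q s) * (?q (Sup K) - ?q (Inf K)))
            - (\<Sum>(s, K)\<in>\<D>. g (p t) * (p (Sup K) - p (Inf K)))"
        using additive_tagged_division_1[OF less_imp_le[OF cd] D(1), of p]
        by (simp add: case_prod_unfold flip: sum_distrib_left)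
      also have "\<dots> = (\<Sum>(s, K)\<in>\<D>. (g (p s) - g (p t)) * (p (Sup K) - p (Inf K)))"
        unfolding sum_subtractf[symmetric]
      proof (rule sum.cong)
        fix x assume x: "x \<in> \<D>"
        obtain s K where tK: "x = (s, K)" by (cases x)
        obtain u v where uv: "u \<le> s" "s \<le> v" "c \<le> u" "v \<le> d" "Inf K = u" "Sup K = v"
          using tagged_division_cellE[OF D(1), of s K] x tK by metis
        then show "(case x of (s, K) \<Rightarrow> g (?q s) * (?q (Sup K) - ?q (Inf K)))
            - (case x of (s, K) \<Rightarrow> g (p t) * (p (Sup K) - p (Inf K)))
            = (case x of (s, K) \<Rightarrow> (g (p s) - g (p t)) * (p (Sup K) - p (Inf K)))"
          by (simp add: tK algebra_simps)
      qed simp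
      also have "cmod \<dots> \<le> e * variation p c d"
      proof (rule derivative_along_sum_le[OF bv' less_imp_le[OF cd] _ D,
            where h = "\<lambda>u s v. (g (p s) - g (p t)) * (p v - p u)"])
        fix u s v assume us: "c \<le> u" "u \<le> s" "s \<le> v" "v \<le> d"
        have "cmod (g (p s) - g (p t)) \<le> e"
        proof -
          have "dist s t < \<delta>" using us t unfolding dist_real_def by linarith
          then show ?thesis using \<delta>(2)[of s t] us t by (simp add: dist_norm)
        qed
        moreover have "cmod (p v - p u) \<le> variation p u v"
          using chord_le_variation[OF bv'] us by simp
        ultimately show "cmod ((g (p s) - g (p t)) * (p v - p u)) \<le> e * variation p u v"
          using e by (simp add: norm_mult mult_mono)
      qed
      finally have "cmod ((\<Sum>(s, K)\<in>\<D>. g (?q s) * (?q (Sup K) - ?q (Inf K))) - g (p t) * (p d - p c))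
          \<le> e * variation p c d" .
      moreover have "cmod ((\<Sum>(s, K)\<in>\<D>. g (?q s) * (?q (Sup K) - ?q (Inf K))) - (F d - F c)) < \<eta>"
        using r(2) D by blast
      moreover have "cmod (u - w) \<le> cmod (S - w) + cmod (S - u)" for u w S :: complex
        using norm_triangle_ineq4[of "S - w" "S - u"] by simp
      ultimately show "cmod (F d - F c - g (p t) * (p d - p c)) \<le> e * variation p c d + \<eta>"
        by (meson add_mono less_imp_le order_trans)
    qed
  qed
  then show "\<exists>\<delta>>0. \<forall>c t d. a \<le> c \<and> c \<le> t \<and> t \<le> d \<and> d \<le> b \<and> d - c < \<delta> \<longrightarrow>
        cmod (F d - F c - g (p t) * (p d - p c)) \<le> e * variation p c d"
    using \<delta>(1) by blast
qed

lemma continuous_on_interval_bounded: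
  fixes H :: "real \<Rightarrow> complex"
  assumes "continuous_on {a..b} H"
  shows "\<exists>C>0. \<forall>t\<in>{a..b}. cmod (H t) \<le> C"
proof -
  have "bounded (H ` {a..b})"
    using assms by (intro compact_imp_bounded compact_continuous_image) auto
  then show ?thesis unfolding bounded_pos by auto
qed

lemma derivative_along_lipschitz:
  assumes bv: "bounded_variation p a b" and der: "derivative_along p a b F G"
    and C: "\<And>t. t \<in> {a..b} \<Longrightarrow> cmod (G t) \<le> C" and cd: "a \<le> c" "c \<le> d" "d \<le> b"
  shows "cmod (F d - F c) \<le> (C + 1) * variation p c d"
proof -
  obtain \<delta> where \<delta>: "\<delta> > 0"
    "\<And>c t d. a \<le> c \<Longrightarrow> c \<le> t \<Longrightarrow> t \<le> d \<Longrightarrow> d \<le> b \<Longrightarrow> d - c < \<delta> \<Longrightarrow>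
       cmod (F d - F c - G t * (p d - p c)) \<le> 1 * variation p c d"
    using derivative_alongD[OF der zero_less_one] by blast
  obtain \<D> where D: "\<D> tagged_division_of {c..d}" "\<forall>(t, K)\<in>\<D>. Sup K - Inf K < \<delta>"
    using mesh_division_exists[OF \<delta>(1)] by blast
  have "F d - F c = (\<Sum>(t, K)\<in>\<D>. F (Sup K) - F (Inf K))"
    using additive_tagged_division_1[OF cd(2) D(1), of F] by simp
  also have "cmod \<dots> \<le> (C + 1) * variation p c d"
  proof (rule derivative_along_sum_le[OF bounded_variation_subinterval[OF bv cd] cd(2) _ D,
        where h = "\<lambda>u s v. F v - F u"])
    fix u s v assume us: "c \<le> u" "u \<le> s" "s \<le> v" "v \<le> d" "v - u < \<delta>"
    have "cmod (G s) * cmod (p v - p u) \<le> C * variation p u v"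
      using C[of s] chord_le_variation[OF bv, of u v] us cd order_trans[OF norm_ge_zero C[of s]]
      by (intro mult_mono) auto
    moreover have "cmod (F v - F u - G s * (p v - p u)) \<le> variation p u v"
      using \<delta>(2)[of u s v] us cd by simp
    moreover have "cmod (F v - F u) \<le> cmod (F v - F u - G s * (p v - p u)) + cmod (G s * (p v - p u))"
      by norm
    ultimately show "cmod (F v - F u) \<le> (C + 1) * variation p u v"
      unfolding norm_mult distrib_right by linarith
  qed
  finally show ?thesis .
qed

text \<open>
  If \<open>G\<close> and \<open>G'\<close> differ at \<open>t\<close>, then \<open>\<bar>G - G'\<bar>\<close> is at least some \<open>h > 0\<close> near \<open>t\<close>. Subtracting the two
  local estimates with \<open>\<epsilon> = h/4\<close> shows that chords of \<open>p\<close> near \<open>t\<close> are at most half of the variation.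
  Since the variation is the least additive majorant of the chords, it vanishes there, so \<open>p\<close> would
  have a constant subpath.
\<close>

lemma derivative_along_unique:
  assumes bv: "bounded_variation p a b" and ab: "a < b"
    and nonconst: "\<And>c d. a \<le> c \<Longrightarrow> c < d \<Longrightarrow> d \<le> b \<Longrightarrow> \<exists>t\<in>{c..d}. p t \<noteq> p c"
    and der: "derivative_along p a b F G" "derivative_along p a b F G'"
    and cont: "continuous_on {a..b} G" "continuous_on {a..b} G'" and t: "t \<in> {a..b}"
  shows "G t = G' t"
proof (rule ccontr)
  assume "G t \<noteq> G' t"
  define h where "h = cmod (G t - G' t) / 2"
  have h: "h > 0" "h < cmod (G t - G' t)" using \<open>G t \<noteq> G' t\<close> by (auto simp: h_def)
  have "continuous_on {a..b} (\<lambda>t. cmod (G t - G' t))" using cont by (intro continuous_intros)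
  then obtain r where r: "r > 0" "\<And>s. s \<in> {a..b} \<Longrightarrow> dist s t < r \<Longrightarrow>
      dist (cmod (G s - G' s)) (cmod (G t - G' t)) < h"
    unfolding continuous_on_iff using t h(1) by meson
  obtain \<delta>1 where \<delta>1: "\<delta>1 > 0" "\<And>c t d. a \<le> c \<Longrightarrow> c \<le> t \<Longrightarrow> t \<le> d \<Longrightarrow> d \<le> b \<Longrightarrow> d - c < \<delta>1 \<Longrightarrow>
       cmod (F d - F c - G t * (p d - p c)) \<le> h/4 * variation p c d"
    using derivative_alongD[OF der(1), of "h/4"] h by auto
  obtain \<delta>2 where \<delta>2: "\<delta>2 > 0" "\<And>c t d. a \<le> c \<Longrightarrow> c \<le> t \<Longrightarrow> t \<le> d \<Longrightarrow> d \<le> b \<Longrightarrow> d - c < \<delta>2 \<Longrightarrow>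
       cmod (F d - F c - G' t * (p d - p c)) \<le> h/4 * variation p c d"
    using derivative_alongD[OF der(2), of "h/4"] h by auto
  define \<delta> where "\<delta> = min r (min \<delta>1 \<delta>2)"
  have \<delta>: "\<delta> > 0" using r \<delta>1 \<delta>2 by (simp add: \<delta>_def)
  have "\<exists>c d. a \<le> c \<and> c \<le> t \<and> t \<le> d \<and> d \<le> b \<and> c < d \<and> d - c < \<delta>"
  proof (cases "t < b")
    case True
    then show ?thesis using t \<delta> by (intro exI[of _ t] exI[of _ "min b (t + \<delta>/2)"]) auto
  next
    case False
    then show ?thesis using t ab \<delta> by (intro exI[of _ "max a (t - \<delta>/2)"] exI[of _ t]) auto
  qed
  then obtain c d where cd: "a \<le> c" "c \<le> t" "t \<le> d" "d \<le> b" "c < d" "d - c < \<delta>" by blast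
  \<comment> \<open>The majorant \<open>variation p a t / 2\<close> turns this into a bound for the variation by its own half.\<close>
  have half: "cmod (p v - p u) \<le> variation p u v / 2" if uv: "c \<le> u" "u \<le> v" "v \<le> d" for u v
  proof -
    have "h \<le> cmod (G u - G' u)"
    proof -
      have "dist (cmod (G u - G' u)) (cmod (G t - G' t)) < h"
        using uv cd by (intro r(2)) (auto simp: \<delta>_def dist_real_def)
      then show ?thesis unfolding dist_real_def h_def by linarith
    qed
    then have "h * cmod (p v - p u) \<le> cmod ((G u - G' u) * (p v - p u))"
      by (simp add: norm_mult mult_right_mono)
    also have "(G u - G' u) * (p v - p u)
        = (F v - F u - G' u * (p v - p u)) - (F v - F u - G u * (p v - p u))"
      by (simp add: algebra_simps)
    also have "cmod \<dots> \<le> h/4 * variation p u v + h/4 * variation p u v"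
      using \<delta>2(2)[of u u v] \<delta>1(2)[of u u v] uv cd unfolding \<delta>_def
      by (intro order_trans[OF norm_triangle_ineq4 add_mono]) auto
    finally have "h * cmod (p v - p u) \<le> h * (variation p u v / 2)" by simp
    then show ?thesis using h(1) by simp
  qed
  have "variation p c d \<le> variation p a d / 2 - variation p a c / 2"
  proof (rule variation_le_majorant)
    fix u v assume "c \<le> u" "u \<le> v" "v \<le> d"
    then show "cmod (p v - p u) \<le> variation p a v / 2 - variation p a u / 2"
      using half[of u v] variation_diff[OF bv, of u v] cd by (simp add: field_simps)
  qed (use cd in auto)
  then have V0: "variation p c d \<le> 0" using variation_diff[OF bv, of c d] cd by simp
  obtain s where s: "s \<in> {c..d}" "p s \<noteq> p c" using nonconst[of c d] cd by auto
  have "cmod (p s - p c) \<le> variation p c s" using chord_le_variation[OF bv] s cd by simp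
  also have "\<dots> \<le> variation p c d"
    using variation_additive[OF bv, of c s d] variation_nonneg[OF bv, of s d] s cd by simp
  finally have "cmod (p s - p c) \<le> 0" using V0 by linarith
  then show False using s(2) by simp
qed

lemma derivative_along_add:
  assumes "derivative_along p a b F G" "derivative_along p a b F' G'"
  shows "derivative_along p a b (\<lambda>t. F t + F' t) (\<lambda>t. G t + G' t)"
  unfolding derivative_along_def
proof (intro allI impI)
  fix e :: real assume "e > 0"
  then have e: "e/2 > 0" by simp
  obtain \<delta>1 where \<delta>1: "\<delta>1 > 0" "\<And>c t d. a \<le> c \<Longrightarrow> c \<le> t \<Longrightarrow> t \<le> d \<Longrightarrow> d \<le> b \<Longrightarrow> d - c < \<delta>1 \<Longrightarrow>
       cmod (F d - F c - G t * (p d - p c)) \<le> e/2 * variation p c d"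
    using derivative_alongD[OF assms(1) e] by blast
  obtain \<delta>2 where \<delta>2: "\<delta>2 > 0" "\<And>c t d. a \<le> c \<Longrightarrow> c \<le> t \<Longrightarrow> t \<le> d \<Longrightarrow> d \<le> b \<Longrightarrow> d - c < \<delta>2 \<Longrightarrow>
       cmod (F' d - F' c - G' t * (p d - p c)) \<le> e/2 * variation p c d"
    using derivative_alongD[OF assms(2) e] by blast
  have "cmod (F d + F' d - (F c + F' c) - (G t + G' t) * (p d - p c)) \<le> e * variation p c d"
    if "a \<le> c \<and> c \<le> t \<and> t \<le> d \<and> d \<le> b \<and> d - c < min \<delta>1 \<delta>2" for c t d
  proof -
    have "F d + F' d - (F c + F' c) - (G t + G' t) * (p d - p c)
        = (F d - F c - G t * (p d - p c)) + (F' d - F' c - G' t * (p d - p c))"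
      by (simp add: algebra_simps)
    also have "cmod \<dots> \<le> e/2 * variation p c d + e/2 * variation p c d"
      using \<delta>1(2)[of c t d] \<delta>2(2)[of c t d] that
      by (intro order_trans[OF norm_triangle_ineq] add_mono) auto
    finally show ?thesis by simp
  qed
  then show "\<exists>\<delta>>0. \<forall>c t d. a \<le> c \<and> c \<le> t \<and> t \<le> d \<and> d \<le> b \<and> d - c < \<delta> \<longrightarrow>
        cmod (F d + F' d - (F c + F' c) - (G t + G' t) * (p d - p c)) \<le> e * variation p c d"
    using \<delta>1(1) \<delta>2(1) by (intro exI[of _ "min \<delta>1 \<delta>2"]) auto
qed

lemma derivative_along_const:
  assumes "bounded_variation p a b"
  shows "derivative_along p a b (\<lambda>t. k) (\<lambda>t. 0)"
  unfolding derivative_along_def using variation_nonneg[OF assms]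
  by (intro allI impI exI[of _ 1]) auto

lemma derivative_along_mult:
  assumes bv: "bounded_variation p a b"
    and der: "derivative_along p a b F G" "derivative_along p a b F' G'"
    and cont: "continuous_on {a..b} F" "continuous_on {a..b} F'"
      "continuous_on {a..b} G" "continuous_on {a..b} G'"
  shows "derivative_along p a b (\<lambda>t. F t * F' t) (\<lambda>t. G t * F' t + F t * G' t)"
  unfolding derivative_along_def
proof (intro allI impI)
  fix e :: real assume e0: "e > 0"
  note bdd = continuous_on_interval_bounded
  have "\<exists>C>0. \<forall>t\<in>{a..b}. cmod (F t) \<le> C \<and> cmod (F' t) \<le> C \<and> cmod (G t) \<le> C \<and> cmod (G' t) \<le> C"
  proof -
    obtain C1 C2 C3 C4 where "C1 > 0" "C2 > 0" "C3 > 0" "C4 > 0"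
      "\<forall>t\<in>{a..b}. cmod (F t) \<le> C1" "\<forall>t\<in>{a..b}. cmod (F' t) \<le> C2"
      "\<forall>t\<in>{a..b}. cmod (G t) \<le> C3" "\<forall>t\<in>{a..b}. cmod (G' t) \<le> C4"
      using bdd[OF cont(1)] bdd[OF cont(2)] bdd[OF cont(3)] bdd[OF cont(4)] by blast
    then show ?thesis by (intro exI[of _ "C1 + C2 + C3 + C4"]) (auto intro: order_trans)
  qed
  then obtain C where C: "C > 0" "\<And>t. t \<in> {a..b} \<Longrightarrow>
      cmod (F t) \<le> C \<and> cmod (F' t) \<le> C \<and> cmod (G t) \<le> C \<and> cmod (G' t) \<le> C" by blast
  define e' where "e' = e / (4 * C)"
  have e': "e' > 0" "C * e' = e/4" using e0 C(1) by (auto simp: e'_def field_simps)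
  obtain \<delta>1 where \<delta>1: "\<delta>1 > 0" "\<And>c t d. a \<le> c \<Longrightarrow> c \<le> t \<Longrightarrow> t \<le> d \<Longrightarrow> d \<le> b \<Longrightarrow> d - c < \<delta>1 \<Longrightarrow>
       cmod (F d - F c - G t * (p d - p c)) \<le> e' * variation p c d"
    using derivative_alongD[OF der(1) e'(1)] by blast
  obtain \<delta>2 where \<delta>2: "\<delta>2 > 0" "\<And>c t d. a \<le> c \<Longrightarrow> c \<le> t \<Longrightarrow> t \<le> d \<Longrightarrow> d \<le> b \<Longrightarrow> d - c < \<delta>2 \<Longrightarrow>
       cmod (F' d - F' c - G' t * (p d - p c)) \<le> e' * variation p c d"
    using derivative_alongD[OF der(2) e'(1)] by blast
  have "uniformly_continuous_on {a..b} F" "uniformly_continuous_on {a..b} F'"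
    using cont by (auto simp: compact_uniformly_continuous)
  then obtain r1 r2 where r: "r1 > 0" "r2 > 0"
    "\<And>s t. s \<in> {a..b} \<Longrightarrow> t \<in> {a..b} \<Longrightarrow> dist s t < r1 \<Longrightarrow> dist (F s) (F t) < e'"
    "\<And>s t. s \<in> {a..b} \<Longrightarrow> t \<in> {a..b} \<Longrightarrow> dist s t < r2 \<Longrightarrow> dist (F' s) (F' t) < e'"
    unfolding uniformly_continuous_on_def using e'(1) by metis
  define \<delta> where "\<delta> = min (min \<delta>1 \<delta>2) (min r1 r2)"
  have "\<delta> > 0" using \<delta>1 \<delta>2 r by (simp add: \<delta>_def)
  moreover have "cmod (F d * F' d - F c * F' c - (G t * F' t + F t * G' t) * (p d - p c)) \<le> e * variation p c d"
    if t: "a \<le> c" "c \<le> t" "t \<le> d" "d \<le> b" "d - c < \<delta>" for c t d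
  proof -
    let ?V = "variation p c d"
    have V: "?V \<ge> 0" "cmod (p d - p c) \<le> ?V"
      using variation_nonneg[OF bv, of c d] chord_le_variation[OF bv, of c d] t by auto
    have 1: "cmod (F' d * (F d - F c - G t * (p d - p c))) \<le> C * (e' * ?V)"
      unfolding norm_mult using \<delta>1(2)[of c t d] C(2)[of d] t C(1) by (intro mult_mono) (auto simp: \<delta>_def)
    have 2: "cmod (F c * (F' d - F' c - G' t * (p d - p c))) \<le> C * (e' * ?V)"
      unfolding norm_mult using \<delta>2(2)[of c t d] C(2)[of c] t C(1) by (intro mult_mono) (auto simp: \<delta>_def)
    have "cmod (F' d - F' t) \<le> e'" "cmod (F c - F t) \<le> e'"
      using r(3)[of c t] r(4)[of d t] t by (auto simp: \<delta>_def dist_norm dist_real_def)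
    then have 3: "cmod (G t * ((F' d - F' t) * (p d - p c))) \<le> C * (e' * ?V)"
      and 4: "cmod (G' t * ((F c - F t) * (p d - p c))) \<le> C * (e' * ?V)"
      unfolding norm_mult using C(2)[of t] t C(1) e'(1) V by (auto intro!: mult_mono)
    \<comment> \<open>The last two terms correct for evaluating \<open>F'\<close> and \<open>F\<close> at the endpoints instead of at \<open>t\<close>.\<close>
    have "F d * F' d - F c * F' c - (G t * F' t + F t * G' t) * (p d - p c)
      = F' d * (F d - F c - G t * (p d - p c)) + F c * (F' d - F' c - G' t * (p d - p c))
        + G t * ((F' d - F' t) * (p d - p c)) + G' t * ((F c - F t) * (p d - p c))"
      by (simp add: algebra_simps)
    also have "cmod \<dots> \<le> C * (e' * ?V) + C * (e' * ?V) + C * (e' * ?V) + C * (e' * ?V)"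
      by (intro order_trans[OF norm_triangle_ineq] add_mono 1 2 3 4)
    also have "\<dots> = 4 * (C * e') * ?V" by simp
    also have "\<dots> = e * ?V" unfolding e'(2) by simp
    finally show ?thesis .
  qed
  ultimately show "\<exists>\<delta>>0. \<forall>c t d. a \<le> c \<and> c \<le> t \<and> t \<le> d \<and> d \<le> b \<and> d - c < \<delta> \<longrightarrow>
        cmod (F d * F' d - F c * F' c - (G t * F' t + F t * G' t) * (p d - p c)) \<le> e * variation p c d"
    by blast
qed

text \<open>
  Chords of \<open>q\<close>, and therefore its variation, are bounded by a multiple of the variation of \<open>p\<close>. So
  an error that is small relative to \<open>q\<close> is also small relative to \<open>p\<close>.
\<close>

lemma derivative_along_chain:
  assumes bvp: "bounded_variation p a b" and bvq: "bounded_variation q a b"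
    and q: "derivative_along p a b q Q" and F: "derivative_along q a b F G"
    and cont: "continuous_on {a..b} Q" "continuous_on {a..b} G"
  shows "derivative_along p a b F (\<lambda>t. G t * Q t)"
  unfolding derivative_along_def
proof (intro allI impI)
  fix e :: real assume e0: "e > 0"
  obtain C where C: "C > 0" "\<And>t. t \<in> {a..b} \<Longrightarrow> cmod (Q t) \<le> C"
    using continuous_on_interval_bounded[OF cont(1)] by blast
  obtain D where D: "D > 0" "\<And>t. t \<in> {a..b} \<Longrightarrow> cmod (G t) \<le> D"
    using continuous_on_interval_bounded[OF cont(2)] by blast
  have lip: "variation q c d \<le> (C + 1) * variation p c d" if cd: "a \<le> c" "c \<le> d" "d \<le> b" for c d
  proof -
    have "variation q c d \<le> (C + 1) * variation p a d - (C + 1) * variation p a c"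
    proof (rule variation_le_majorant)
      fix u v assume "c \<le> u" "u \<le> v" "v \<le> d"
      then show "cmod (q v - q u) \<le> (C + 1) * variation p a v - (C + 1) * variation p a u"
        using derivative_along_lipschitz[OF bvp q C(2), of u v] variation_diff[OF bvp, of u v] cd
        by (simp add: algebra_simps)
    qed (use cd in auto)
    also have "\<dots> = (C + 1) * (variation p a d - variation p a c)" by (simp only: right_diff_distrib)
    finally show ?thesis using variation_diff[OF bvp, of c d] cd by simp
  qed
  define e1 where "e1 = e / (2 * (C + 1))"
  define e2 where "e2 = e / (2 * D)"
  have e1: "e1 > 0" "e1 * (C + 1) = e/2" and e2: "e2 > 0" "D * e2 = e/2"
    using e0 C(1) D(1) by (auto simp: e1_def e2_def field_simps)
  obtain \<delta>1 where \<delta>1: "\<delta>1 > 0" "\<And>c t d. a \<le> c \<Longrightarrow> c \<le> t \<Longrightarrow> t \<le> d \<Longrightarrow> d \<le> b \<Longrightarrow> d - c < \<delta>1 \<Longrightarrow>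
       cmod (F d - F c - G t * (q d - q c)) \<le> e1 * variation q c d"
    using derivative_alongD[OF F e1(1)] by blast
  obtain \<delta>2 where \<delta>2: "\<delta>2 > 0" "\<And>c t d. a \<le> c \<Longrightarrow> c \<le> t \<Longrightarrow> t \<le> d \<Longrightarrow> d \<le> b \<Longrightarrow> d - c < \<delta>2 \<Longrightarrow>
       cmod (q d - q c - Q t * (p d - p c)) \<le> e2 * variation p c d"
    using derivative_alongD[OF q e2(1)] by blast
  have "cmod (F d - F c - G t * Q t * (p d - p c)) \<le> e * variation p c d"
    if t: "a \<le> c" "c \<le> t" "t \<le> d" "d \<le> b" "d - c < min \<delta>1 \<delta>2" for c t d
  proof -
    have "cmod (F d - F c - G t * (q d - q c)) \<le> e1 * variation q c d" using \<delta>1(2)[of c t d] t by simp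
    also have "\<dots> \<le> e1 * ((C + 1) * variation p c d)" using lip[of c d] t e1(1) by (intro mult_left_mono) auto
    also have "\<dots> = e/2 * variation p c d" by (simp only: mult.assoc[symmetric] e1(2))
    finally have 1: "cmod (F d - F c - G t * (q d - q c)) \<le> e/2 * variation p c d" .
    have "cmod (G t * (q d - q c - Q t * (p d - p c))) \<le> D * (e2 * variation p c d)"
      unfolding norm_mult using D(1) D(2)[of t] \<delta>2(2)[of c t d] t by (intro mult_mono) auto
    also have "\<dots> = e/2 * variation p c d" by (simp only: mult.assoc[symmetric] e2(2))
    finally have 2: "cmod (G t * (q d - q c - Q t * (p d - p c))) \<le> e/2 * variation p c d" .
    have "F d - F c - G t * Q t * (p d - p c)
      = (F d - F c - G t * (q d - q c)) + G t * (q d - q c - Q t * (p d - p c))"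
      by (simp add: algebra_simps)
    also have "cmod \<dots> \<le> e/2 * variation p c d + e/2 * variation p c d"
      by (intro order_trans[OF norm_triangle_ineq] add_mono 1 2)
    finally show ?thesis by simp
  qed
  then show "\<exists>\<delta>>0. \<forall>c t d. a \<le> c \<and> c \<le> t \<and> t \<le> d \<and> d \<le> b \<and> d - c < \<delta> \<longrightarrow>
        cmod (F d - F c - G t * Q t * (p d - p c)) \<le> e * variation p c d"
    using \<delta>1(1) \<delta>2(1) by (intro exI[of _ "min \<delta>1 \<delta>2"]) auto
qed

lemma derivative_along_bounded_variation:
  assumes bvp: "bounded_variation p a b" and q: "derivative_along p a b q Q"
    and cont: "continuous_on {a..b} Q" and ab: "a \<le> b"
  shows "bounded_variation q a b"
proof -
  obtain C where C: "\<And>t. t \<in> {a..b} \<Longrightarrow> cmod (Q t) \<le> C"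
    using continuous_on_interval_bounded[OF cont] by blast
  show ?thesis
  proof (rule bounded_variation_majorant[OF ab])
    fix u v assume "a \<le> u" "u \<le> v" "v \<le> b"
    then show "cmod (q v - q u) \<le> (C + 1) * variation p a v - (C + 1) * variation p a u"
      using derivative_along_lipschitz[OF bvp q C, of u v] variation_diff[OF bvp, of u v]
      by (simp add: algebra_simps)
  qed
qed


section \<open>Path length parametrisations\<close>

text \<open>
  Let \<open>v t\<close> be the variation over \<open>[a, t]\<close>. It is continuous, hence maps \<open>[a, b]\<close> onto \<open>[0, L]\<close>, which
  gives uniqueness of the path length parametrisation. Points with equal \<open>v\<close> have equal image,
  because chords are bounded by the variation; so any right inverse \<open>\<tau>\<close> of \<open>v\<close> yields existence. The
  same bound makes the result Lipschitz with constant \<open>1\<close>.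
\<close>

lemma path_length_param_exists:
  assumes rect: "rectifiable \<gamma>" and nonconst: "\<not> constant_path \<gamma>"
  defines "\<eta> \<equiv> path_length_param \<gamma>"
  shows "lo \<eta> = 0" "hi \<eta> = path_len \<gamma>" "path_len \<gamma> > 0" "is_path \<eta>"
    and "\<And>t. t \<in> {lo \<gamma>..hi \<gamma>} \<Longrightarrow> pt \<eta> (path_variation \<gamma> (lo \<gamma>) t) = pt \<gamma> t"
    and "\<And>s s'. s \<in> {0..path_len \<gamma>} \<Longrightarrow> s' \<in> {0..path_len \<gamma>} \<Longrightarrow> cmod (pt \<eta> s' - pt \<eta> s) \<le> \<bar>s' - s\<bar>"
proof -
  define a b p where "a = lo \<gamma>" and "b = hi \<gamma>" and "p = pt \<gamma>"
  define v where "v = variation p a"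
  define L where "L = v b"
  have ab: "a < b" and cont: "continuous_on {a..b} p" and bv: "bounded_variation p a b"
    using rect unfolding rectifiable_def is_path_def bounded_variation_def a_def b_def p_def by auto
  have pv: "path_variation \<gamma> (lo \<gamma>) = v" "path_len \<gamma> = L"
    unfolding path_variation_def path_len_def v_def L_def a_def b_def p_def by auto
  have va: "v a = 0" unfolding v_def using variation_refl[OF bv] ab by simp
  have vm: "v s \<le> v t" if "a \<le> s" "s \<le> t" "t \<le> b" for s t
    unfolding v_def using variation_mono[OF bv that] .
  have vt: "v t \<in> {0..L}" if "t \<in> {a..b}" for t
    using vm[of a t] vm[of t b] that va unfolding L_def by simp
  have chord: "cmod (p t - p s) \<le> \<bar>v t - v s\<bar>" if "s \<in> {a..b}" "t \<in> {a..b}" for s t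
  proof -
    have *: "cmod (p t - p s) \<le> v t - v s" if "a \<le> s" "s \<le> t" "t \<le> b" for s t
      using chord_le_variation[OF bv that] variation_diff[OF bv that] by (simp add: v_def)
    show ?thesis using *[of s t] *[of t s] that by (cases "s \<le> t") (auto simp: norm_minus_commute)
  qed
  have surj: "\<exists>t\<in>{a..b}. v t = s" if "s \<in> {0..L}" for s
  proof -
    have "continuous_on {a..b} v" unfolding v_def by (rule continuous_variation[OF bv cont])
    from IVT'[of v a s b, OF _ _ _ this] show ?thesis using that ab va unfolding L_def by auto
  qed
  define \<tau> where "\<tau> s = (SOME t. t \<in> {a..b} \<and> v t = s)" for s
  have \<tau>: "\<tau> s \<in> {a..b} \<and> v (\<tau> s) = s" if "s \<in> {0..L}" for s
    unfolding \<tau>_def by (rule someI_ex) (use surj[OF that] in blast)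
  have L: "L > 0"
  proof (rule ccontr)
    assume "\<not> L > 0"
    then have "v t = 0" if "t \<in> {a..b}" for t using vt[OF that] by simp
    then have "p t = p a" if "t \<in> {a..b}" for t using chord[of a t] that ab by simp
    then show False using nonconst unfolding constant_path_def a_def b_def p_def by blast
  qed
  define e where "e = restrict (\<lambda>s. p (\<tau> s)) {0..L}"
  have e: "e (v t) = p t" if "t \<in> {a..b}" for t
    using chord[of t "\<tau> (v t)"] \<tau>[OF vt[OF that]] vt[OF that] that by (simp add: e_def)
  have lip: "cmod (e s' - e s) \<le> \<bar>s' - s\<bar>" if "s \<in> {0..L}" "s' \<in> {0..L}" for s s'
    using chord[of "\<tau> s" "\<tau> s'"] \<tau>[OF that(1)] \<tau>[OF that(2)] that by (simp add: e_def)
  have econt: "continuous_on {0..L} e"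
    unfolding continuous_on_iff
  proof (intro ballI allI impI)
    fix s r :: real assume s: "s \<in> {0..L}" and r: "r > 0"
    have "dist (e s') (e s) < r" if "s' \<in> {0..L}" "dist s' s < r" for s'
      using lip[OF s that(1)] that(2) by (simp add: dist_norm)
    then show "\<exists>d>0. \<forall>s'\<in>{0..L}. dist s' s < d \<longrightarrow> dist (e s') (e s) < r"
      using r by blast
  qed
  let ?P = "\<lambda>\<eta>. is_path \<eta> \<and> lo \<eta> = 0 \<and> hi \<eta> = L \<and> (\<forall>t\<in>{a..b}. pt \<eta> (v t) = p t)"
  have P: "?P (Plane_Path 0 L e)"
    unfolding is_path_def using L econt e by (auto simp: e_def)
  have "\<eta> = (THE \<eta>. ?P \<eta>)"
    unfolding \<eta>_def path_length_param_def pv a_def b_def p_def ..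
  also have "\<dots> = Plane_Path 0 L e"
  proof (rule the_equality)
    show "?P (Plane_Path 0 L e)" by (rule P)
    fix \<zeta> assume \<zeta>: "?P \<zeta>"
    have "pt \<zeta> = e"
    proof (rule extensionalityI[of _ "{0..L}"])
      show "pt \<zeta> \<in> extensional {0..L}" using \<zeta> unfolding is_path_def by auto
      show "e \<in> extensional {0..L}" by (simp add: e_def)
      show "pt \<zeta> s = e s" if "s \<in> {0..L}" for s
        using surj[OF that] \<zeta> e by auto
    qed
    then show "\<zeta> = Plane_Path 0 L e" using \<zeta> by (cases \<zeta>) auto
  qed
  finally have \<eta>: "\<eta> = Plane_Path 0 L e" .
  show "lo \<eta> = 0" "hi \<eta> = path_len \<gamma>" "path_len \<gamma> > 0" "is_path \<eta>"
    using P L by (auto simp: \<eta> pv)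
  show "pt \<eta> (path_variation \<gamma> (lo \<gamma>) t) = pt \<gamma> t" if "t \<in> {lo \<gamma>..hi \<gamma>}" for t
    using e[of t] that by (simp add: \<eta> pv a_def b_def p_def)
  show "cmod (pt \<eta> s' - pt \<eta> s) \<le> \<bar>s' - s\<bar>"
    if "s \<in> {0..path_len \<gamma>}" "s' \<in> {0..path_len \<gamma>}" for s s'
    using lip[of s s'] that by (simp add: \<eta> pv)
qed

text \<open>
  The condition defining \<open>\<mm>(\<G>)\<close> says that \<open>F_deriv Y \<G> f\<close> is the derivative of \<open>f\<close> along the path
  length parametrisation \<open>\<eta>\<close>. As \<open>p = \<eta> \<circ> v\<close> with \<open>v\<close> uniformly continuous, short intervals for \<open>p\<close>
  correspond to short intervals for \<open>\<eta>\<close>, and the variation of \<open>\<eta>\<close> over \<open>[v c, v d]\<close> is at most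
  \<open>v d - v c\<close>, the variation of \<open>p\<close> over \<open>[c, d]\<close>.
\<close>

lemma derivative_along_length_param:
  assumes rect: "rectifiable \<gamma>" and nonconst: "\<not> constant_path \<gamma>"
    and max: "path_length_param \<gamma> \<in> maximal_paths Y \<G>" and f: "f \<in> F_differentiable Y \<G>"
  shows "derivative_along (pt \<gamma>) (lo \<gamma>) (hi \<gamma>) (\<lambda>t. f (pt \<gamma> t)) (\<lambda>t. F_deriv Y \<G> f (pt \<gamma> t))"
proof -
  define \<eta> where "\<eta> = path_length_param \<gamma>"
  define L where "L = path_len \<gamma>"
  define a b p where "a = lo \<gamma>" and "b = hi \<gamma>" and "p = pt \<gamma>"
  define v where "v = variation p a"
  define g where "g = F_deriv Y \<G> f"
  note pl = path_length_param_exists[OF rect nonconst, folded \<eta>_def L_def]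
  have ab: "a < b" and cont: "continuous_on {a..b} p" and bv: "bounded_variation p a b"
    using rect unfolding rectifiable_def is_path_def bounded_variation_def a_def b_def p_def by auto
  have pv: "path_variation \<gamma> (lo \<gamma>) = v" "path_len \<gamma> = v b"
    unfolding path_variation_def path_len_def v_def a_def b_def p_def by auto
  have vm: "v s \<le> v t" if "a \<le> s" "s \<le> t" "t \<le> b" for s t
    unfolding v_def using variation_mono[OF bv that] .
  have va: "v a = 0" unfolding v_def using variation_refl[OF bv] ab by simp
  have vt: "v t \<in> {0..L}" if "t \<in> {a..b}" for t
    using vm[of a t] vm[of t b] that va unfolding L_def pv by simp
  have \<eta>p: "pt \<eta> (v t) = p t" if "t \<in> {a..b}" for t
    using pl(5)[of t] that unfolding pv a_def b_def p_def by simp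
  have lip: "cmod (pt \<eta> s' - pt \<eta> s) \<le> s' - s" if "0 \<le> s" "s \<le> s'" "s' \<le> L" for s s'
    using pl(6)[of s s'] that by simp
  have bv\<eta>: "bounded_variation (pt \<eta>) 0 L"
    by (rule bounded_variation_majorant[where w = "\<lambda>s. s"]) (use lip pl(3) in auto)
  have trace: "path_in Y \<eta>" and pd: "path_derivative Y \<eta> f g"
    using max f unfolding \<eta>_def g_def maximal_paths_def by auto
  have der\<eta>: "derivative_along (pt \<eta>) 0 L (\<lambda>s. f (pt \<eta> s)) (\<lambda>s. g (pt \<eta> s))"
  proof (rule integrals_imp_derivative_along[OF bv\<eta>])
    have "continuous_on Y g" using pd unfolding path_derivative_def Cont_def by simp
    moreover have "pt \<eta> ` {0..L} \<subseteq> Y"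
      using trace pl(1,2) unfolding path_in_def path_trace_def by simp
    moreover have "continuous_on {0..L} (pt \<eta>)" using pl(1,2,4) unfolding is_path_def by simp
    ultimately show "continuous_on {0..L} (\<lambda>s. g (pt \<eta> s))"
      by (metis continuous_on_compose2)
    fix c d assume cd: "0 \<le> c" "c < d" "d \<le> L"
    let ?\<sigma> = "Plane_Path c d (restrict (pt \<eta>) {c..d})"
    have "is_subpath ?\<sigma> \<eta>"
      unfolding is_subpath_def using cd pl(1,2) by (intro exI[of _ c] exI[of _ d]) simp
    then show "has_path_integral g ?\<sigma> (f (pt \<eta> d) - f (pt \<eta> c))"
      using pd cd unfolding path_derivative_def path_start_def path_end_def by fastforce
  qed
  have "derivative_along p a b (\<lambda>t. f (p t)) (\<lambda>t. g (p t))"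
    unfolding derivative_along_def
  proof (intro allI impI)
    fix e :: real assume e: "e > 0"
    obtain \<delta> where \<delta>: "\<delta> > 0"
      "\<And>c t d. 0 \<le> c \<Longrightarrow> c \<le> t \<Longrightarrow> t \<le> d \<Longrightarrow> d \<le> L \<Longrightarrow> d - c < \<delta> \<Longrightarrow>
       cmod (f (pt \<eta> d) - f (pt \<eta> c) - g (pt \<eta> t) * (pt \<eta> d - pt \<eta> c)) \<le> e * variation (pt \<eta>) c d"
      using derivative_alongD[OF der\<eta> e] by blast
    have "continuous_on {a..b} v" unfolding v_def by (rule continuous_variation[OF bv cont])
    then have "uniformly_continuous_on {a..b} v" by (simp add: compact_uniformly_continuous)
    then obtain r where r: "r > 0"
      "\<And>s t. s \<in> {a..b} \<Longrightarrow> t \<in> {a..b} \<Longrightarrow> dist s t < r \<Longrightarrow> dist (v s) (v t) < \<delta>"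
      unfolding uniformly_continuous_on_def using \<delta>(1) by metis
    have "cmod (f (p d) - f (p c) - g (p t) * (p d - p c)) \<le> e * variation p c d"
      if t: "a \<le> c" "c \<le> t" "t \<le> d" "d \<le> b" "d - c < r" for c t d
    proof -
      have "v d - v c < \<delta>" using r(2)[of d c] t by (auto simp: dist_real_def)
      moreover have "0 \<le> v c" "v d \<le> L" "v c \<le> v t" "v t \<le> v d"
        using vt[of c] vt[of d] vm[of c t] vm[of t d] t by auto
      ultimately have "cmod (f (p d) - f (p c) - g (p t) * (p d - p c)) \<le> e * variation (pt \<eta>) (v c) (v d)"
        using \<delta>(2)[of "v c" "v t" "v d"] \<eta>p[of c] \<eta>p[of d] \<eta>p[of t] t by simp
      also have "variation (pt \<eta>) (v c) (v d) \<le> v d - v c"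
        using vt[of c] vt[of d] vm[of c d] t lip by (intro variation_le_majorant[where w = "\<lambda>s. s"]) auto
      also have "\<dots> = variation p c d" unfolding v_def using variation_diff[OF bv, of c d] t by simp
      finally show ?thesis using e by simp
    qed
    then show "\<exists>\<delta>>0. \<forall>c t d. a \<le> c \<and> c \<le> t \<and> t \<le> d \<and> d \<le> b \<and> d - c < \<delta> \<longrightarrow>
        cmod (f (p d) - f (p c) - g (p t) * (p d - p c)) \<le> e * variation p c d"
      using r(1) by blast
  qed
  then show ?thesis unfolding a_def b_def p_def g_def .
qed


section \<open>Derivatives with respect to an effective collection\<close>

text \<open>
  Unlike \<^const>\<open>is_F_derivative\<close>, this does not ask for extensional functions, so that the rules of
  differentiation can be stated for plain sums, products and composites.
\<close>

definition derivative_on ::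
  "complex set \<Rightarrow> plane_path set \<Rightarrow> (complex \<Rightarrow> complex) \<Rightarrow> (complex \<Rightarrow> complex) \<Rightarrow> bool" where
  "derivative_on X \<F> f g \<longleftrightarrow> continuous_on X f \<and> continuous_on X g \<and>
     (\<forall>\<gamma>\<in>\<F>. derivative_along (pt \<gamma>) (lo \<gamma>) (hi \<gamma>) (\<lambda>t. f (pt \<gamma> t)) (\<lambda>t. g (pt \<gamma> t)))"

lemma effective_path:
  assumes "effective X \<F>" "\<gamma> \<in> \<F>"
  shows "lo \<gamma> < hi \<gamma>" "continuous_on {lo \<gamma>..hi \<gamma>} (pt \<gamma>)" "bounded_variation (pt \<gamma>) (lo \<gamma>) (hi \<gamma>)"
    and "\<And>t. t \<in> {lo \<gamma>..hi \<gamma>} \<Longrightarrow> pt \<gamma> t \<in> X"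
    and "pt \<gamma> \<in> extensional {lo \<gamma>..hi \<gamma>}"
proof -
  have "path_in X \<gamma>" "admissible \<gamma>" using assms unfolding effective_def by auto
  then show "lo \<gamma> < hi \<gamma>" "continuous_on {lo \<gamma>..hi \<gamma>} (pt \<gamma>)" "bounded_variation (pt \<gamma>) (lo \<gamma>) (hi \<gamma>)"
    "pt \<gamma> \<in> extensional {lo \<gamma>..hi \<gamma>}" "\<And>t. t \<in> {lo \<gamma>..hi \<gamma>} \<Longrightarrow> pt \<gamma> t \<in> X"
    unfolding path_in_def is_path_def admissible_def rectifiable_def bounded_variation_def path_trace_def
    by auto
qed

lemma effective_path_continuous:
  assumes "effective X \<F>" "\<gamma> \<in> \<F>" "continuous_on X f"
  shows "continuous_on {lo \<gamma>..hi \<gamma>} (\<lambda>t. f (pt \<gamma> t))"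
  using effective_path[OF assms(1,2)] assms(3) by (intro continuous_on_compose2[OF assms(3)]) auto

lemma derivative_on_cong:
  assumes "effective X \<F>" "derivative_on X \<F> f g"
    "\<And>x. x \<in> X \<Longrightarrow> f x = f' x" "\<And>x. x \<in> X \<Longrightarrow> g x = g' x"
  shows "derivative_on X \<F> f' g'"
proof -
  have "continuous_on X f'" "continuous_on X g'"
    using assms(2-4) continuous_on_cong[OF refl, of X f f'] continuous_on_cong[OF refl, of X g g']
    unfolding derivative_on_def by auto
  moreover have "derivative_along (pt \<gamma>) (lo \<gamma>) (hi \<gamma>) (\<lambda>t. f' (pt \<gamma> t)) (\<lambda>t. g' (pt \<gamma> t))"
    if "\<gamma> \<in> \<F>" for \<gamma>
  proof (rule derivative_along_cong)
    show "derivative_along (pt \<gamma>) (lo \<gamma>) (hi \<gamma>) (\<lambda>t. f (pt \<gamma> t)) (\<lambda>t. g (pt \<gamma> t))"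
      using assms(2) that unfolding derivative_on_def by blast
  qed (use effective_path(4)[OF assms(1) that] assms(3,4) in metis)+
  ultimately show ?thesis unfolding derivative_on_def by blast
qed

text \<open>
  Closure under subpaths turns the integral condition on the members of \<open>\<F>\<close> into an integral condition
  on all of their subpaths, which is the local condition.
\<close>

lemma is_F_derivative_iff:
  assumes eff: "effective X \<F>"
  shows "is_F_derivative X \<F> f g \<longleftrightarrow> f \<in> extensional X \<and> g \<in> extensional X \<and> derivative_on X \<F> f g"
proof -
  have "(\<forall>\<gamma>\<in>\<F>. has_path_integral g \<gamma> (f (path_end \<gamma>) - f (path_start \<gamma>)))
    \<longleftrightarrow> (\<forall>\<gamma>\<in>\<F>. derivative_along (pt \<gamma>) (lo \<gamma>) (hi \<gamma>) (\<lambda>t. f (pt \<gamma> t)) (\<lambda>t. g (pt \<gamma> t)))"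
    if g: "continuous_on X g"
  proof (intro iffI ballI)
    fix \<gamma> assume \<gamma>: "\<gamma> \<in> \<F>"
      and int: "\<forall>\<gamma>\<in>\<F>. has_path_integral g \<gamma> (f (path_end \<gamma>) - f (path_start \<gamma>))"
    show "derivative_along (pt \<gamma>) (lo \<gamma>) (hi \<gamma>) (\<lambda>t. f (pt \<gamma> t)) (\<lambda>t. g (pt \<gamma> t))"
    proof (rule integrals_imp_derivative_along)
      fix c d assume cd: "lo \<gamma> \<le> c" "c < d" "d \<le> hi \<gamma>"
      let ?\<sigma> = "Plane_Path c d (restrict (pt \<gamma>) {c..d})"
      have "is_subpath ?\<sigma> \<gamma>" unfolding is_subpath_def using cd by blast
      then have "?\<sigma> \<in> \<F>" using eff \<gamma> unfolding effective_def by blast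
      then show "has_path_integral g ?\<sigma> (f (pt \<gamma> d) - f (pt \<gamma> c))"
        using int cd unfolding path_start_def path_end_def by fastforce
    qed (use effective_path[OF eff \<gamma>] effective_path_continuous[OF eff \<gamma> g] in auto)
  next
    fix \<gamma> assume \<gamma>: "\<gamma> \<in> \<F>"
      and der: "\<forall>\<gamma>\<in>\<F>. derivative_along (pt \<gamma>) (lo \<gamma>) (hi \<gamma>) (\<lambda>t. f (pt \<gamma> t)) (\<lambda>t. g (pt \<gamma> t))"
    have "has_path_integral g (Plane_Path (lo \<gamma>) (hi \<gamma>) (restrict (pt \<gamma>) {lo \<gamma>..hi \<gamma>}))
       (f (pt \<gamma> (hi \<gamma>)) - f (pt \<gamma> (lo \<gamma>)))"
      using der \<gamma> effective_path[OF eff \<gamma>] by (intro derivative_along_imp_integral) auto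
    then show "has_path_integral g \<gamma> (f (path_end \<gamma>) - f (path_start \<gamma>))"
      using extensional_restrict[OF effective_path(5)[OF eff \<gamma>]]
      by (simp add: path_start_def path_end_def)
  qed
  then show ?thesis unfolding is_F_derivative_def derivative_on_def Cont_def by blast
qed

text \<open>
  The two candidates agree on the traces of all paths in \<open>\<F>\<close>, which have no constant subpaths, and
  these traces are dense in \<open>X\<close>.
\<close>

lemma derivative_on_unique:
  assumes eff: "effective X \<F>" and X: "closed X"
    and der: "derivative_on X \<F> f g" "derivative_on X \<F> f g'" and x: "x \<in> X"
  shows "g x = g' x"
proof -
  have cont: "continuous_on X g" "continuous_on X g'" using der unfolding derivative_on_def by auto
  let ?S = "{x \<in> X. g x - g' x = 0}"
  have "closed ?S"
    using cont X by (intro continuous_closed_preimage_constant continuous_intros) auto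
  moreover have "\<Union> (path_trace ` \<F>) \<subseteq> ?S"
  proof clarify
    fix z \<gamma> assume \<gamma>: "\<gamma> \<in> \<F>" and z: "z \<in> path_trace \<gamma>"
    then obtain t where t: "t \<in> {lo \<gamma>..hi \<gamma>}" "z = pt \<gamma> t" unfolding path_trace_def by blast
    have "g (pt \<gamma> t) = g' (pt \<gamma> t)"
    proof (rule derivative_along_unique[OF effective_path(3,1)[OF eff \<gamma>] _ _ _ _ _ t(1)])
      fix c d assume cd: "lo \<gamma> \<le> c" "c < d" "d \<le> hi \<gamma>"
      let ?\<sigma> = "Plane_Path c d (restrict (pt \<gamma>) {c..d})"
      have "is_subpath ?\<sigma> \<gamma>" unfolding is_subpath_def using cd by blast
      then have "\<not> constant_path ?\<sigma>" using eff \<gamma> unfolding effective_def admissible_def by blast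
      then show "\<exists>t\<in>{c..d}. pt \<gamma> t \<noteq> pt \<gamma> c" unfolding constant_path_def by auto
    qed (use der \<gamma> cont effective_path_continuous[OF eff \<gamma>] in \<open>auto simp: derivative_on_def\<close>)
    then show "z \<in> X \<and> g z - g' z = 0" using t effective_path(4)[OF eff \<gamma>] by auto
  qed
  ultimately have "closure (\<Union> (path_trace ` \<F>)) \<subseteq> ?S" by (simp add: closure_minimal)
  then have "x \<in> ?S" using eff x unfolding effective_def by blast
  then show ?thesis by simp
qed

lemma F_deriv_eq:
  assumes eff: "effective X \<F>" and X: "closed X" and der: "derivative_on X \<F> f g"
  shows "F_deriv X \<F> (restrict f X) = restrict g X" "restrict f X \<in> F_differentiable X \<F>"
proof -
  have d: "is_F_derivative X \<F> (restrict f X) (restrict g X)"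
    unfolding is_F_derivative_iff[OF eff] using derivative_on_cong[OF eff der] by simp
  then show "restrict f X \<in> F_differentiable X \<F>"
    unfolding F_differentiable_def is_F_derivative_def by blast
  show "F_deriv X \<F> (restrict f X) = restrict g X" unfolding F_deriv_def
  proof (rule the_equality)
    show "is_F_derivative X \<F> (restrict f X) (restrict g X)" by (rule d)
    fix h assume "is_F_derivative X \<F> (restrict f X) h"
    then have h: "h \<in> extensional X" "derivative_on X \<F> (restrict f X) h"
      unfolding is_F_derivative_iff[OF eff] by auto
    have "derivative_on X \<F> (restrict f X) (restrict g X)"
      using d unfolding is_F_derivative_iff[OF eff] by blast
    then have "h x = restrict g X x" if "x \<in> X" for x
      by (rule derivative_on_unique[OF eff X h(2) _ that])
    then show "h = restrict g X" by (rule extensionalityI[OF h(1) restrict_extensional])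
  qed
qed

lemma F_differentiableD:
  assumes eff: "effective X \<F>" and X: "closed X" and f: "f \<in> F_differentiable X \<F>"
  shows "derivative_on X \<F> f (F_deriv X \<F> f)" "f \<in> extensional X"
proof -
  obtain g where "is_F_derivative X \<F> f g" using f unfolding F_differentiable_def by blast
  then have g: "derivative_on X \<F> f g" "f \<in> extensional X" "g \<in> extensional X"
    unfolding is_F_derivative_iff[OF eff] by auto
  then have "F_deriv X \<F> f = g"
    using F_deriv_eq(1)[OF eff X g(1)] by (simp add: extensional_restrict)
  then show "derivative_on X \<F> f (F_deriv X \<F> f)" "f \<in> extensional X" using g by auto
qed

lemma derivative_on_add:
  assumes "derivative_on X \<F> f f'" "derivative_on X \<F> g g'"
  shows "derivative_on X \<F> (\<lambda>x. f x + g x) (\<lambda>x. f' x + g' x)"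
  using assms unfolding derivative_on_def by (auto intro!: continuous_intros derivative_along_add)

lemma derivative_on_const:
  assumes "effective X \<F>"
  shows "derivative_on X \<F> (\<lambda>x. k) (\<lambda>x. 0)"
  using effective_path(3)[OF assms] unfolding derivative_on_def
  by (auto intro!: derivative_along_const)

lemma derivative_on_mult:
  assumes eff: "effective X \<F>" and "derivative_on X \<F> f f'" "derivative_on X \<F> g g'"
  shows "derivative_on X \<F> (\<lambda>x. f x * g x) (\<lambda>x. f' x * g x + f x * g' x)"
  using assms(2,3) effective_path(3)[OF eff] effective_path_continuous[OF eff] unfolding derivative_on_def
  by (auto intro!: continuous_intros derivative_along_mult)

lemma derivative_on_sum:
  assumes eff: "effective X \<F>" and "finite K" "\<And>k. k \<in> K \<Longrightarrow> derivative_on X \<F> (f k) (f' k)"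
  shows "derivative_on X \<F> (\<lambda>x. \<Sum>k\<in>K. f k x) (\<lambda>x. \<Sum>k\<in>K. f' k x)"
  using assms(2,3)
  by (induction K rule: finite_induct) (auto intro: derivative_on_const[OF eff] derivative_on_add)

text \<open>
  Along \<open>\<gamma> \<in> \<F>\<close> the function \<open>q = \<phi> \<circ> \<gamma>\<close> has derivative \<open>\<phi>' \<circ> \<gamma>\<close>, so by the chain rule it is
  enough that \<open>f \<circ> q\<close> has derivative \<open>F_deriv Y \<G> f \<circ> q\<close> along \<open>q\<close>. Compatibility provides exactly
  this unless \<open>q\<close> is constant, when both sides of the estimate vanish.
\<close>

lemma derivative_on_compose:
  assumes eff: "effective X \<F>" and X: "closed X" and Y: "closed Y" and effG: "effective Y \<G>"
    and comp: "compatible X \<F> Y \<G> \<phi>" and f: "f \<in> F_differentiable Y \<G>"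
  shows "derivative_on X \<F> (\<lambda>x. f (\<phi> x)) (\<lambda>x. F_deriv Y \<G> f (\<phi> x) * F_deriv X \<F> \<phi> x)"
proof -
  define g where "g = F_deriv Y \<G> f"
  define \<phi>' where "\<phi>' = F_deriv X \<F> \<phi>"
  have \<phi>: "derivative_on X \<F> \<phi> \<phi>'"
    using comp F_differentiableD[OF eff X] unfolding compatible_def \<phi>'_def by blast
  have \<phi>Y: "\<phi> ` X \<subseteq> Y" using comp unfolding compatible_def by blast
  have fg: "continuous_on Y f" "continuous_on Y g"
    using F_differentiableD(1)[OF effG Y f] unfolding derivative_on_def g_def by auto
  have c\<phi>: "continuous_on X \<phi>" "continuous_on X \<phi>'" using \<phi> unfolding derivative_on_def by auto
  have cf: "continuous_on X (\<lambda>x. f (\<phi> x))" and cg: "continuous_on X (\<lambda>x. g (\<phi> x))"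
    using continuous_on_compose2[OF fg(1) c\<phi>(1) \<phi>Y] continuous_on_compose2[OF fg(2) c\<phi>(1) \<phi>Y] by auto
  have "derivative_along (pt \<gamma>) (lo \<gamma>) (hi \<gamma>) (\<lambda>t. f (\<phi> (pt \<gamma> t))) (\<lambda>t. g (\<phi> (pt \<gamma> t)) * \<phi>' (pt \<gamma> t))"
    if \<gamma>: "\<gamma> \<in> \<F>" for \<gamma>
  proof -
    define a b p where "a = lo \<gamma>" and "b = hi \<gamma>" and "p = pt \<gamma>"
    define q where "q = (\<lambda>t. \<phi> (p t))"
    note e = effective_path[OF eff \<gamma>, folded a_def b_def p_def]
    have cont: "continuous_on {a..b} (\<lambda>t. h (p t))" if "continuous_on X h" for h
      using effective_path_continuous[OF eff \<gamma> that] unfolding a_def b_def p_def .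
    have q: "derivative_along p a b q (\<lambda>t. \<phi>' (p t))"
      using \<phi> \<gamma> unfolding derivative_on_def q_def a_def b_def p_def by blast
    have bvq: "bounded_variation q a b"
      using derivative_along_bounded_variation[OF e(3) q cont[OF c\<phi>(2)]] e(1) by simp
    let ?q = "path_compose \<phi> \<gamma>"
    have lohi: "lo ?q = a" "hi ?q = b" and qt: "\<And>t. t \<in> {a..b} \<Longrightarrow> pt ?q t = q t"
      unfolding path_compose_def a_def b_def q_def p_def by (auto simp: compose_def)
    have "derivative_along q a b (\<lambda>t. f (q t)) (\<lambda>t. g (q t))"
    proof (cases "constant_path ?q")
      case True
      then obtain z where "\<And>t. t \<in> {a..b} \<Longrightarrow> q t = z"
        using qt unfolding constant_path_def lohi by force
      then show ?thesis unfolding derivative_along_def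
        using variation_nonneg[OF bvq] by (intro allI impI exI[of _ 1]) auto
    next
      case False
      have "variation_sums (pt ?q) a b = variation_sums q a b"
        using e(1) qt by (intro variation_cong) auto
      then have "rectifiable ?q"
        using bvq e(1) continuous_on_cong[OF refl, of "{a..b}" "pt ?q" q] cont[OF c\<phi>(1)] qt
        unfolding rectifiable_def is_path_def lohi bounded_variation_def q_def
        by (simp add: path_compose_def a_def b_def)
      moreover have "path_length_param ?q \<in> maximal_paths Y \<G>"
        using comp \<gamma> False unfolding compatible_def by blast
      ultimately have "derivative_along (pt ?q) a b (\<lambda>t. f (pt ?q t)) (\<lambda>t. g (pt ?q t))"
        using derivative_along_length_param[OF _ False _ f] unfolding lohi g_def by blast
      then show ?thesis by (rule derivative_along_cong) (use qt in auto)
    qed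
    then have "derivative_along p a b (\<lambda>t. f (q t)) (\<lambda>t. g (q t) * \<phi>' (p t))"
      using cont[OF c\<phi>(2)] cont[OF cg] unfolding q_def
      by (intro derivative_along_chain[OF e(3) bvq[unfolded q_def] q[unfolded q_def]]) auto
    then show ?thesis unfolding a_def b_def p_def q_def .
  qed
  then show ?thesis
    using cf cg c\<phi>(2) unfolding derivative_on_def g_def \<phi>'_def
    by (auto intro!: continuous_intros)
qed


section \<open>Higher derivatives of products and composites\<close>

lemma Dn_Suc_iff:
  "f \<in> Dn X \<F> (Suc n) \<longleftrightarrow> (\<forall>k\<le>n. F_higher_deriv X \<F> k f \<in> F_differentiable X \<F>)"
proof (induction n arbitrary: f)
  case 0
  then show ?case by (simp add: F_higher_deriv_def)
next
  case (Suc n)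
  have "F_higher_deriv X \<F> k (F_deriv X \<F> f) = F_higher_deriv X \<F> (Suc k) f" for k
    by (simp add: F_higher_deriv_def funpow_swap1)
  moreover have "F_higher_deriv X \<F> 0 f = f" by (simp add: F_higher_deriv_def)
  moreover have "(\<forall>k\<le>Suc n. P k) \<longleftrightarrow> P 0 \<and> (\<forall>k\<le>n. P (Suc k))" for P
    by (metis Suc_le_mono le0 not0_implies_Suc)
  ultimately show ?case using Suc.IH[of "F_deriv X \<F> f"] by simp
qed

lemma Dinf_iff:
  "f \<in> Dinf X \<F> \<longleftrightarrow> (\<forall>k. F_higher_deriv X \<F> k f \<in> F_differentiable X \<F>)"
proof -
  have "f \<in> Dinf X \<F> \<longleftrightarrow> (\<forall>n. f \<in> Dn X \<F> (Suc n))"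
    unfolding Dinf_def by (auto simp: Suc_le_eq gr0_conv_Suc)
  then show ?thesis unfolding Dn_Suc_iff by blast
qed

lemma Dinf_derivative_on:
  assumes "effective X \<F>" "closed X" "f \<in> Dinf X \<F>"
  shows "derivative_on X \<F> (F_higher_deriv X \<F> n f) (F_higher_deriv X \<F> (Suc n) f)"
  using F_differentiableD(1)[OF assms(1,2)] assms(3) unfolding Dinf_iff
  by (metis F_higher_deriv_def comp_apply funpow.simps(2))

text \<open>
  A sequence of functions, each a derivative of the one before, exhibits membership in \<open>D\<^sup>\<infinity>\<close> and at
  the same time computes all higher derivatives; by uniqueness they are the members of the sequence.
\<close>

lemma derivative_chain_Dinf:
  assumes eff: "effective X \<F>" and X: "closed X" and s: "\<And>n. derivative_on X \<F> (s n) (s (Suc n))"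
  shows "F_higher_deriv X \<F> n (restrict (s 0) X) = restrict (s n) X"
    and "restrict (s 0) X \<in> Dinf X \<F>"
proof -
  show *: "F_higher_deriv X \<F> n (restrict (s 0) X) = restrict (s n) X" for n
  proof (induction n)
    case 0
    then show ?case by (simp add: F_higher_deriv_def)
  next
    case (Suc n)
    have "F_higher_deriv X \<F> (Suc n) (restrict (s 0) X)
        = F_deriv X \<F> (F_higher_deriv X \<F> n (restrict (s 0) X))"
      by (simp only: F_higher_deriv_def funpow.simps comp_apply)
    then show ?case unfolding Suc.IH F_deriv_eq(1)[OF eff X s] .
  qed
  show "restrict (s 0) X \<in> Dinf X \<F>"
    unfolding Dinf_iff * using F_deriv_eq(2)[OF eff X s] by blast
qed

text \<open>
  Pascal's rule, as it is used to pass from one Leibniz formula to the next.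
\<close>

lemma leibniz_step:
  fixes a b :: "nat \<Rightarrow> 'a::comm_ring_1"
  shows "(\<Sum>k\<le>n. of_nat (n choose k) * (a (Suc k) * b (n - k) + a k * b (Suc (n - k))))
    = (\<Sum>k\<le>Suc n. of_nat (Suc n choose k) * (a k * b (Suc n - k)))"
proof -
  have "(\<Sum>k\<le>Suc n. of_nat (Suc n choose k) * (a k * b (Suc n - k)))
      = a 0 * b (Suc n) + (\<Sum>k\<le>n. of_nat (n choose Suc k) * (a (Suc k) * b (n - k)))
        + (\<Sum>k\<le>n. of_nat (n choose k) * (a (Suc k) * b (n - k)))"
    by (subst sum.atMost_Suc_shift) (simp add: sum.distrib algebra_simps)
  also have "a 0 * b (Suc n) + (\<Sum>k\<le>n. of_nat (n choose Suc k) * (a (Suc k) * b (n - k)))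
      = (\<Sum>k\<le>Suc n. of_nat (n choose k) * (a k * b (Suc n - k)))"
    by (subst sum.atMost_Suc_shift) (simp add: binomial_eq_0)
  also have "\<dots> = (\<Sum>k\<le>n. of_nat (n choose k) * (a k * b (Suc (n - k))))"
    by (simp add: Suc_diff_le binomial_eq_0)
  finally show ?thesis by (simp add: sum.distrib algebra_simps)
qed

lemma derivative_on_leibniz:
  assumes eff: "effective X \<F>"
    and a: "\<And>k. k \<le> n \<Longrightarrow> derivative_on X \<F> (a k) (a (Suc k))"
    and b: "\<And>k. k \<le> n \<Longrightarrow> derivative_on X \<F> (b k) (b (Suc k))"
  shows "derivative_on X \<F> (\<lambda>x. \<Sum>k\<le>n. of_nat (n choose k) * (a k x * b (n - k) x))
    (\<lambda>x. \<Sum>k\<le>Suc n. of_nat (Suc n choose k) * (a k x * b (Suc n - k) x))"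
proof -
  have "derivative_on X \<F> (\<lambda>x. \<Sum>k\<le>n. of_nat (n choose k) * (a k x * b (n - k) x))
    (\<lambda>x. \<Sum>k\<le>n. 0 * (a k x * b (n - k) x) + of_nat (n choose k) * (a (Suc k) x * b (n - k) x + a k x * b (Suc (n - k)) x))"
    using a b by (intro derivative_on_sum derivative_on_mult derivative_on_const eff) auto
  then show ?thesis using leibniz_step[of n "\<lambda>k. a k x" "\<lambda>k. b k x" for x] by simp
qed

text \<open>
  For sequences \<open>f\<close> and \<open>\<phi>\<close> of successive derivatives, \<open>comp_deriv f \<phi> n i\<close> is the \<open>n\<close>-th derivative of
  \<open>f i \<circ> \<phi> 0\<close>. The recursion applies the Leibniz rule of order \<open>n\<close> to the product
  \<open>(f (i+1) \<circ> \<phi> 0) * \<phi> 1\<close>, the first derivative; keeping \<open>i\<close> general lets it close up without an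
  explicit Faa di Bruno formula.
\<close>

fun comp_deriv :: "(nat \<Rightarrow> complex \<Rightarrow> complex) \<Rightarrow> (nat \<Rightarrow> complex \<Rightarrow> complex) \<Rightarrow> nat \<Rightarrow> nat \<Rightarrow> complex \<Rightarrow> complex"
  where
  "comp_deriv f \<phi> 0 i = (\<lambda>x. f i (\<phi> 0 x))"
| "comp_deriv f \<phi> (Suc n) i =
     (\<lambda>x. \<Sum>k\<le>n. of_nat (n choose k) * (comp_deriv f \<phi> k (Suc i) x * \<phi> (Suc (n - k)) x))"

lemma derivative_on_comp_deriv:
  assumes eff: "effective X \<F>"
    and f: "\<And>i. derivative_on X \<F> (\<lambda>x. f i (\<phi> 0 x)) (\<lambda>x. f (Suc i) (\<phi> 0 x) * \<phi> 1 x)"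
    and \<phi>: "\<And>j. derivative_on X \<F> (\<phi> j) (\<phi> (Suc j))"
  shows "derivative_on X \<F> (comp_deriv f \<phi> n i) (comp_deriv f \<phi> (Suc n) i)"
proof (induction n arbitrary: i rule: less_induct)
  case (less n)
  show ?case
  proof (cases n)
    case 0
    then show ?thesis using f[of i] by simp
  next
    case (Suc m)
    have "derivative_on X \<F>
        (\<lambda>x. \<Sum>k\<le>m. of_nat (m choose k) * (comp_deriv f \<phi> k (Suc i) x * \<phi> (Suc (m - k)) x))
        (\<lambda>x. \<Sum>k\<le>Suc m. of_nat (Suc m choose k) * (comp_deriv f \<phi> k (Suc i) x * \<phi> (Suc (Suc m - k)) x))"
      using Suc by (intro derivative_on_leibniz[OF eff, where b = "\<lambda>k. \<phi> (Suc k)"] less.IH \<phi>) auto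
    then show ?thesis unfolding Suc comp_deriv.simps .
  qed
qed


section \<open>Weighted sums of partial Bell polynomials\<close>

text \<open>
  The exponential generating function of \<open>a\<^sub>1, a\<^sub>2, \<dots>\<close>, divided by \<open>x\<close>.
\<close>

definition reduced_egf :: "(nat \<Rightarrow> real) \<Rightarrow> real fps" where
  "reduced_egf a = Abs_fps (\<lambda>m. a (Suc m) / fact (Suc m))"

text \<open>
  The partial Bell polynomial \<open>B\<^bsub>n,i\<^esub>(a\<^sub>1, a\<^sub>2, \<dots>)\<close>, given by its generating function.
\<close>

definition bell :: "(nat \<Rightarrow> real) \<Rightarrow> nat \<Rightarrow> nat \<Rightarrow> real" where
  "bell a n i = fact n / fact i * fps_nth ((fps_X * reduced_egf a) ^ i) n"

lemma bell_0: "bell a 0 0 = 1" "bell a (Suc n) 0 = 0"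
  by (simp_all add: bell_def)

text \<open>
  Compare coefficients in \<open>(\<psi>\<^bsup>i+1\<^esup> / (i+1)!)' = \<psi>\<^bsup>i\<^esup> / i! * \<psi>'\<close>. This is the same recursion in \<open>n\<close> as
  that of \<^const>\<open>comp_deriv\<close>.
\<close>

lemma bell_Suc:
  "bell a (Suc n) (Suc i) = (\<Sum>k\<le>n. real (n choose k) * (bell a k i * a (Suc (n - k))))"
proof -
  let ?\<psi> = "fps_X * reduced_egf a"
  have "real (Suc n) * fps_nth (?\<psi> ^ Suc i) (Suc n) = fps_nth (fps_deriv (?\<psi> ^ Suc i)) n"
    by (simp only: fps_deriv_nth Suc_eq_plus1)
  also have "fps_deriv (?\<psi> ^ Suc i) = fps_const (real (Suc i)) * (?\<psi> ^ i * fps_deriv ?\<psi>)"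
    by (subst fps_deriv_power) (simp only: diff_Suc_1 mult_ac)
  also have "fps_nth \<dots> n = real (Suc i) * (\<Sum>k\<le>n. fps_nth (?\<psi> ^ i) k * (a (Suc (n - k)) / fact (n - k)))"
  proof -
    have "fps_nth (fps_deriv ?\<psi>) m = a (Suc m) / fact m" for m
      by (simp add: fps_deriv_nth reduced_egf_def del: fps_deriv_mult of_nat_Suc)
    then show ?thesis by (simp only: fps_mult_left_const_nth) (simp only: fps_mult_nth atMost_atLeast0)
  qed
  finally have *: "real (Suc n) * fps_nth (?\<psi> ^ Suc i) (Suc n)
    = real (Suc i) * (\<Sum>k\<le>n. fps_nth (?\<psi> ^ i) k * (a (Suc (n - k)) / fact (n - k)))" .
  have "bell a (Suc n) (Suc i)
      = fact n / fact (Suc i) * (real (Suc n) * fps_nth (?\<psi> ^ Suc i) (Suc n))"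
    by (simp add: bell_def field_simps)
  also have "\<dots> = fact n / fact i * (\<Sum>k\<le>n. fps_nth (?\<psi> ^ i) k * (a (Suc (n - k)) / fact (n - k)))"
    unfolding * by (simp add: divide_simps del: of_nat_Suc)
  also have "\<dots> = (\<Sum>k\<le>n. real (n choose k) * (bell a k i * a (Suc (n - k))))"
    unfolding sum_distrib_left
  proof (rule sum.cong)
    fix k assume "k \<in> {..n}"
    then have "real (n choose k) = fact n / (fact k * fact (n - k))" by (simp add: binomial_fact)
    then show "fact n / fact i * (fps_nth (?\<psi> ^ i) k * (a (Suc (n - k)) / fact (n - k)))
        = real (n choose k) * (bell a k i * a (Suc (n - k)))"
      by (simp add: bell_def)
  qed simp
  finally show ?thesis .
qed

lemma bell_shift:
  "bell a n i = (if n < i then 0 else fact n / fact i * fps_nth (reduced_egf a ^ i) (n - i))"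
  by (simp add: bell_def power_mult_distrib fps_X_power_mult_nth)

lemma fps_power_nonneg:
  fixes f :: "real fps"
  assumes "\<And>m. fps_nth f m \<ge> 0"
  shows "fps_nth (f ^ i) m \<ge> 0"
  using assms by (induction i arbitrary: m) (auto simp: fps_mult_nth intro!: sum_nonneg)

lemma bell_nonneg:
  assumes "\<And>k. a k \<ge> 0"
  shows "bell a n i \<ge> 0"
proof -
  have "fps_nth (reduced_egf a) m \<ge> 0" for m using assms by (simp add: reduced_egf_def)
  from fps_power_nonneg[OF this] show ?thesis unfolding bell_shift by simp
qed

text \<open>
  The product of the partial sums contains all terms of the Cauchy product up to order \<open>N\<close> and further
  nonnegative ones. Working with partial sums avoids any question of convergence.
\<close>

lemma fps_mult_partial_sum_le:
  fixes f g :: "real fps"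
  assumes f: "\<And>m. fps_nth f m \<ge> 0" and g: "\<And>m. fps_nth g m \<ge> 0" and e: "e \<ge> 0"
  shows "(\<Sum>m\<le>N. fps_nth (f * g) m * e ^ m)
    \<le> (\<Sum>m\<le>N. fps_nth f m * e ^ m) * (\<Sum>m\<le>N. fps_nth g m * e ^ m)"
proof -
  define h where "h k l = (fps_nth f k * e ^ k) * (fps_nth g l * e ^ l)" for k l
  have "(\<Sum>m\<le>N. fps_nth (f * g) m * e ^ m) = (\<Sum>m\<le>N. \<Sum>k\<le>m. h k (m - k))"
  proof (rule sum.cong)
    fix m
    have "fps_nth f k * fps_nth g (m - k) * e ^ m = h k (m - k)" if "k \<le> m" for k
      using that power_add[of e k "m - k"] by (simp add: h_def)
    then show "fps_nth (f * g) m * e ^ m = (\<Sum>k\<le>m. h k (m - k))"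
      by (simp add: fps_mult_nth sum_distrib_right atMost_atLeast0)
  qed simp
  also have "\<dots> = (\<Sum>(k, l)\<in>{(k, l). k + l \<le> N}. h k l)" by (rule sum.triangle_reindex_eq[symmetric])
  also have "\<dots> \<le> (\<Sum>(k, l)\<in>{..N} \<times> {..N}. h k l)"
    using f g e by (intro sum_mono2) (auto simp: h_def)
  also have "\<dots> = (\<Sum>m\<le>N. fps_nth f m * e ^ m) * (\<Sum>m\<le>N. fps_nth g m * e ^ m)"
    unfolding sum_product sum.cartesian_product h_def ..
  finally show ?thesis .
qed

lemma fps_power_partial_sum_le:
  fixes f :: "real fps"
  assumes f: "\<And>m. fps_nth f m \<ge> 0" and e: "e \<ge> 0"
    and T: "(\<Sum>m\<le>N. fps_nth f m * e ^ m) \<le> T"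
  shows "(\<Sum>m\<le>N. fps_nth (f ^ i) m * e ^ m) \<le> T ^ i"
proof (induction i)
  case 0
  have "(\<Sum>m\<le>N. fps_nth (1 :: real fps) m * e ^ m) = (\<Sum>m\<le>N. if m = 0 then 1 else 0)"
    by (rule sum.cong) auto
  then show ?case by simp
next
  case (Suc i)
  have "0 \<le> (\<Sum>m\<le>N. fps_nth f m * e ^ m)" using f e by (intro sum_nonneg) auto
  then have T0: "0 \<le> T" using T by linarith
  have "(\<Sum>m\<le>N. fps_nth (f ^ Suc i) m * e ^ m)
      \<le> (\<Sum>m\<le>N. fps_nth f m * e ^ m) * (\<Sum>m\<le>N. fps_nth (f ^ i) m * e ^ m)"
    using fps_mult_partial_sum_le[OF f fps_power_nonneg[OF f] e] by simp
  also have "\<dots> \<le> T * T ^ i"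
    using Suc T T0 f e fps_power_nonneg[OF f] by (intro mult_mono) (auto intro!: sum_nonneg)
  finally show ?case by simp
qed

lemma sum_geometric_half: "0 \<le> q \<Longrightarrow> q \<le> 1/2 \<Longrightarrow> (\<Sum>m<N. q ^ m) \<le> (2::real)"
proof -
  assume q: "0 \<le> q" "q \<le> 1/2"
  have "(\<Sum>m<N. q ^ m) \<le> (\<Sum>m<N. (1/2) ^ m)" using q by (intro sum_mono power_mono)
  also have "\<dots> = 2 - 2 * (1/2) ^ N" by (induction N) auto
  also have "\<dots> \<le> 2" by simp
  finally show ?thesis .
qed

lemma reduced_egf_partial_sum_le:
  assumes aB: "\<And>k. k \<ge> 1 \<Longrightarrow> a k \<le> fact k * B ^ k"
    and B: "B > 0" and e: "e \<ge> 0" "B * e \<le> 1/2"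
  shows "(\<Sum>m\<le>N. fps_nth (reduced_egf a) m * e ^ m) \<le> a 1 + 2 * B\<^sup>2 * e"
proof -
  have "(\<Sum>m\<le>N. fps_nth (reduced_egf a) m * e ^ m)
      = a 1 + (\<Sum>m<N. fps_nth (reduced_egf a) (Suc m) * e ^ Suc m)"
    by (cases N) (simp_all add: reduced_egf_def sum.atMost_Suc_shift lessThan_Suc_atMost del: power_Suc fact_Suc sum.atMost_Suc)
  also have "(\<Sum>m<N. fps_nth (reduced_egf a) (Suc m) * e ^ Suc m) \<le> (\<Sum>m<N. B\<^sup>2 * e * (B * e) ^ m)"
  proof (rule sum_mono)
    fix m
    have "fps_nth (reduced_egf a) (Suc m) \<le> B ^ Suc (Suc m)"
      using aB[of "Suc (Suc m)"] by (simp add: reduced_egf_def divide_le_eq mult.commute del: fact_Suc power_Suc)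
    then have "fps_nth (reduced_egf a) (Suc m) * e ^ Suc m \<le> B ^ Suc (Suc m) * e ^ Suc m"
      using e(1) by (intro mult_right_mono) auto
    then show "fps_nth (reduced_egf a) (Suc m) * e ^ Suc m \<le> B\<^sup>2 * e * (B * e) ^ m"
      by (simp add: power2_eq_square power_mult_distrib mult_ac)
  qed
  also have "\<dots> = B\<^sup>2 * e * (\<Sum>m<N. (B * e) ^ m)" by (simp add: sum_distrib_left)
  also have "\<dots> \<le> B\<^sup>2 * e * 2"
    using B e by (intro mult_left_mono sum_geometric_half) auto
  finally show ?thesis by simp
qed

lemma sum_shift_le:
  fixes t :: "nat \<Rightarrow> real"
  assumes "\<And>n. t n \<ge> 0" "\<And>n. n < i \<Longrightarrow> t n = 0"
  shows "(\<Sum>n\<le>N. t n) \<le> (\<Sum>m\<le>N. t (i + m))"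
proof -
  have "(\<Sum>n\<le>N. t n) = (\<Sum>n\<in>{i..N}. t n)"
    using assms(2) by (intro sum.mono_neutral_right) auto
  also have "\<dots> \<le> (\<Sum>n\<in>(+) i ` {..N}. t n)"
  proof (rule sum_mono2)
    show "{i..N} \<subseteq> (+) i ` {..N}"
    proof
      fix n assume "n \<in> {i..N}"
      then show "n \<in> (+) i ` {..N}" by (intro image_eqI[of _ _ "n - i"]) auto
    qed
  qed (use assms in auto)
  also have "\<dots> = (\<Sum>m\<le>N. t (i + m))" by (subst sum.reindex) auto
  finally show ?thesis .
qed

text \<open>
  With \<open>\<theta>\<close> for the reduced generating function, \<open>B\<^bsub>i+m,i\<^esub> = (i+m)! / i! * [x^m] \<theta>^i\<close>. A geometric
  bound on the remaining weight turns the sum into a value of \<open>\<theta>^i\<close>.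
\<close>

lemma bell_weighted_sum_le:
  assumes M: "\<And>n. M n > (0::real)" and a: "\<And>k. a k \<ge> 0"
    and aB: "\<And>k. k \<ge> 1 \<Longrightarrow> a k \<le> fact k * B ^ k"
    and B: "B > 0" and e: "e \<ge> 0" "B * e \<le> 1/2" and C: "C \<ge> 0"
    and w: "\<And>m. fact (i + m) / fact i * M i / M (i + m) \<le> C * e ^ m"
  shows "(\<Sum>n\<le>N. bell a n i / M n) \<le> C * (a 1 + 2 * B\<^sup>2 * e) ^ i / M i"
proof -
  let ?\<theta> = "reduced_egf a"
  have \<theta>: "fps_nth ?\<theta> m \<ge> 0" for m using a by (simp add: reduced_egf_def)
  have "(\<Sum>n\<le>N. bell a n i / M n) \<le> (\<Sum>m\<le>N. bell a (i + m) i / M (i + m))"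
    using bell_nonneg[OF a] M by (intro sum_shift_le) (auto simp: bell_shift less_imp_le)
  also have "\<dots> \<le> (\<Sum>m\<le>N. C / M i * (fps_nth (?\<theta> ^ i) m * e ^ m))"
  proof (rule sum_mono)
    fix m
    have "bell a (i + m) i / M (i + m)
        = fps_nth (?\<theta> ^ i) m * (fact (i + m) / fact i * M i / M (i + m)) / M i"
      using M[of i] by (simp add: bell_shift)
    also have "\<dots> \<le> fps_nth (?\<theta> ^ i) m * (C * e ^ m) / M i"
      using fps_power_nonneg[OF \<theta>] M[of i] w[of m] by (intro divide_right_mono mult_left_mono) auto
    finally show "bell a (i + m) i / M (i + m) \<le> C / M i * (fps_nth (?\<theta> ^ i) m * e ^ m)"
      by (simp add: mult_ac)
  qed
  also have "\<dots> = C / M i * (\<Sum>m\<le>N. fps_nth (?\<theta> ^ i) m * e ^ m)" by (simp add: sum_distrib_left)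
  also have "\<dots> \<le> C / M i * (a 1 + 2 * B\<^sup>2 * e) ^ i"
    using C M[of i] by (intro mult_left_mono fps_power_partial_sum_le[OF \<theta> e(1)]
        reduced_egf_partial_sum_le[OF aB B e]) auto
  finally show ?thesis by simp
qed

lemma nonanalytic_geometric_bound:
  assumes M: "\<And>n. M n > 0" and na: "nonanalytic M" and e: "e > 0"
  shows "\<exists>C\<ge>0. \<forall>m. fact m / M m \<le> C * e ^ m"
proof -
  have "\<forall>\<^sub>F m in sequentially. root m (fact m / M m) < e"
    using na e unfolding nonanalytic_def by (rule order_tendstoD)
  then obtain m0 where m0: "\<And>m. m \<ge> m0 \<Longrightarrow> root m (fact m / M m) < e"
    unfolding eventually_sequentially by blast
  let ?c = "\<lambda>m. fact m / M m"
  have pos: "?c m > 0" for m using M[of m] by simp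
  define C where "C = 1 + (\<Sum>m\<le>m0. ?c m / e ^ m)"
  have s: "(\<Sum>m\<le>m0. ?c m / e ^ m) \<ge> 0" using e M by (intro sum_nonneg) (simp add: less_imp_le)
  have "?c m \<le> C * e ^ m" for m
  proof (cases "m \<le> m0")
    case True
    have "?c m / e ^ m \<le> (\<Sum>m\<le>m0. ?c m / e ^ m)"
      using e M True by (intro member_le_sum) (auto simp: less_imp_le)
    then have "?c m / e ^ m \<le> C" by (simp add: C_def)
    then show ?thesis by (simp only: pos_divide_le_eq[OF zero_less_power[OF e]])
  next
    case False
    then have m: "m > 0" "m \<ge> m0" by auto
    have "?c m = root m (?c m) ^ m"
      using m(1) less_imp_le[OF pos] by (rule real_root_pow_pos2[symmetric])
    also have "\<dots> \<le> e ^ m"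
      using m0[OF m(2)] real_root_ge_zero[OF less_imp_le[OF pos]] by (intro power_mono) auto
    also have "\<dots> \<le> C * e ^ m" using s e by (simp add: C_def)
    finally show ?thesis .
  qed
  moreover have "C \<ge> 0" using s by (simp add: C_def)
  ultimately show ?thesis by blast
qed

text \<open>
  The algebra inequality says that the weight is at most \<open>m! / M m\<close>, whatever \<open>i\<close> is.
\<close>

lemma bell_sum_le_algebra_sequence:
  assumes alg: "algebra_sequence M" and na: "nonanalytic M" and a: "\<And>k. a k \<ge> 0"
    and aB: "\<And>k. k \<ge> 1 \<Longrightarrow> a k \<le> fact k * B ^ k"
    and B: "B > 0" and e: "e > 0" "B * e \<le> 1/2"
  shows "\<exists>C\<ge>0. \<forall>i N. (\<Sum>n\<le>N. bell a n i / M n) \<le> C * (a 1 + 2 * B\<^sup>2 * e) ^ i / M i"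
proof -
  have M: "M n > 0" for n using alg unfolding algebra_sequence_def by blast
  obtain C where C: "C \<ge> 0" "\<And>m. fact m / M m \<le> C * e ^ m"
    using nonanalytic_geometric_bound[OF M na e(1)] by blast
  have "(\<Sum>n\<le>N. bell a n i / M n) \<le> C * (a 1 + 2 * B\<^sup>2 * e) ^ i / M i" for i N
  proof (rule bell_weighted_sum_le[OF M a aB B _ e(2) C(1)])
    fix m
    have "real ((i + m) choose i) \<le> M (i + m) / (M i * M m)"
      using alg unfolding algebra_sequence_def by blast
    then have "fact (i + m) / (fact i * fact m) \<le> M (i + m) / (M i * M m)"
      by (simp add: binomial_fact)
    then have "fact (i + m) / fact i * M i / M (i + m) \<le> fact m / M m"
      using M[of i] M[of m] M[of "i + m"] by (simp add: field_simps)
    then show "fact (i + m) / fact i * M i / M (i + m) \<le> C * e ^ m" using C(2)[of m] by linarith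
  qed (use e in auto)
  then show ?thesis using C(1) by blast
qed

text \<open>
  As \<open>a 1 < 1\<close>, a small \<open>e\<close> makes the base of the power in the previous estimate at most \<open>1\<close>.
\<close>

lemma bell_sum_le_contraction:
  assumes alg: "algebra_sequence M" and na: "nonanalytic M" and a: "\<And>k. a k \<ge> 0"
    and aB: "\<And>k. k \<ge> 1 \<Longrightarrow> a k \<le> fact k * B ^ k" and B: "B > 0" and a1: "a 1 < 1"
  shows "\<exists>C\<ge>0. \<forall>i N. (\<Sum>n\<le>N. bell a n i / M n) \<le> C / M i"
proof -
  have M: "M n > 0" for n using alg unfolding algebra_sequence_def by blast
  \<comment> \<open>The first entry keeps \<open>B * e \<le> 1/2\<close>, the second makes \<open>a 1 + 2 * B\<^sup>2 * e \<le> 1\<close>.\<close>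
  define e where "e = min (1 / (2 * B)) ((1 - a 1) / (2 * B\<^sup>2))"
  have e: "e > 0" using B a1 by (simp add: e_def)
  have "B * e \<le> B * (1 / (2 * B))" "2 * B\<^sup>2 * e \<le> 2 * B\<^sup>2 * ((1 - a 1) / (2 * B\<^sup>2))"
    using B unfolding e_def by (intro mult_left_mono; simp)+
  then have *: "B * e \<le> 1/2" "a 1 + 2 * B\<^sup>2 * e \<le> 1" using B by auto
  obtain C where C: "C \<ge> 0"
    "\<And>i N. (\<Sum>n\<le>N. bell a n i / M n) \<le> C * (a 1 + 2 * B\<^sup>2 * e) ^ i / M i"
    using bell_sum_le_algebra_sequence[OF alg na a aB B e *(1)] by blast
  have "C * (a 1 + 2 * B\<^sup>2 * e) ^ i / M i \<le> C / M i" for i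
  proof -
    have "(a 1 + 2 * B\<^sup>2 * e) ^ i \<le> 1" using *(2) a[of 1] e by (intro power_le_one) auto
    then have "C * (a 1 + 2 * B\<^sup>2 * e) ^ i \<le> C" using C(1) by (simp add: mult_left_le)
    then show ?thesis using M[of i] by (simp add: divide_right_mono)
  qed
  then show ?thesis using C by (meson order_trans)
qed

lemma fact_add_ge_power: "fact i * real (Suc i) ^ m \<le> fact (i + m)"
proof (induction m)
  case (Suc m)
  have "fact i * real (Suc i) ^ Suc m = real (Suc i) * (fact i * real (Suc i) ^ m)" by simp
  also have "\<dots> \<le> real (Suc (i + m)) * fact (i + m)" using Suc by (intro mult_mono) auto
  finally show ?case by simp
qed simp

text \<open>
  Iterating the growth condition gives \<open>M (i+m) \<ge> ((i+m)! / i!)\<^sup>2 * M i / K^m\<close>. One of the two factorial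
  quotients cancels that of the weight, the other is at least \<open>(i+1)^m\<close>. So the weight is at most
  \<open>(K / (i+1))^m\<close>, and the sum is at most \<open>(1 + 2 B\<^sup>2 K / (i+1))^i / M i\<close> as soon as \<open>K / (i+1)\<close> is small
  enough for the bound on the generating function. The finitely many remaining \<open>i\<close> are covered by the
  estimate for general algebra sequences, where the base may exceed \<open>1\<close>.
\<close>

lemma bell_sum_le_quadratic_growth:
  assumes alg: "algebra_sequence M" and na: "nonanalytic M" and a: "\<And>k. a k \<ge> 0"
    and aB: "\<And>k. k \<ge> 1 \<Longrightarrow> a k \<le> fact k * B ^ k" and B: "B > 0" and a1: "a 1 \<le> 1"
    and K: "K > 0" "\<And>n. n \<ge> 1 \<Longrightarrow> (real n)\<^sup>2 * M (n - 1) / M n \<le> K"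
  shows "\<exists>C\<ge>0. \<forall>i N. (\<Sum>n\<le>N. bell a n i / M n) \<le> C / M i"
proof -
  have M: "M n > 0" for n using alg unfolding algebra_sequence_def by blast
  have growth: "(fact (i + m) / fact i)\<^sup>2 * M i \<le> K ^ m * M (i + m)" for i m
  proof (induction m)
    case (Suc m)
    have "(real (Suc (i + m)))\<^sup>2 * M (i + m) \<le> K * M (Suc (i + m))"
      using K(2)[of "Suc (i + m)"] M[of "Suc (i + m)"] by (simp add: divide_le_eq)
    then have step: "K ^ m * ((real (Suc (i + m)))\<^sup>2 * M (i + m)) \<le> K ^ m * (K * M (Suc (i + m)))"
      using K(1) by (intro mult_left_mono) auto
    have "(fact (i + Suc m) / fact i)\<^sup>2 * M i
        = (real (Suc (i + m)))\<^sup>2 * ((fact (i + m) / fact i)\<^sup>2 * M i)"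
      by (simp add: power_mult_distrib power_divide)
    also have "\<dots> \<le> (real (Suc (i + m)))\<^sup>2 * (K ^ m * M (i + m))"
      using Suc by (intro mult_left_mono) auto
    also have "\<dots> \<le> K ^ Suc m * M (i + Suc m)" using step by (simp add: mult_ac)
    finally show ?case .
  qed simp
  have weight: "fact (i + m) / fact i * M i / M (i + m) \<le> 1 * (K / real (Suc i)) ^ m" for i m
  proof -
    define r where "r = (fact (i + m) / fact i :: real)"
    have r: "r > 0" "real (Suc i) ^ m \<le> r"
      using fact_add_ge_power[of i m] by (auto simp: r_def field_simps)
    have "r * M i / M (i + m) = (r\<^sup>2 * M i) / (r * M (i + m))"
      using r(1) by (simp add: power2_eq_square)
    also have "\<dots> \<le> (K ^ m * M (i + m)) / (r * M (i + m))"
      using growth[of i m] r(1) M[of "i + m"] unfolding r_def by (intro divide_right_mono) auto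
    also have "\<dots> = K ^ m / r" using M[of "i + m"] by simp
    also have "\<dots> \<le> K ^ m / real (Suc i) ^ m" using r K(1) by (intro divide_left_mono) auto
    finally show ?thesis by (simp add: r_def power_divide)
  qed
  have large: "(\<Sum>n\<le>N. bell a n i / M n) \<le> exp (2 * B\<^sup>2 * K) / M i"
    if i: "B * (K / real (Suc i)) \<le> 1/2" for i N
  proof -
    let ?e = "K / real (Suc i)"
    have "(\<Sum>n\<le>N. bell a n i / M n) \<le> 1 * (a 1 + 2 * B\<^sup>2 * ?e) ^ i / M i"
      by (rule bell_weighted_sum_le[OF M a aB B _ i _ weight]) (use K in auto)
    also have "(a 1 + 2 * B\<^sup>2 * ?e) ^ i \<le> exp (2 * B\<^sup>2 * ?e) ^ i"
    proof (rule power_mono)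
      show "a 1 + 2 * B\<^sup>2 * ?e \<le> exp (2 * B\<^sup>2 * ?e)"
        using a1 exp_ge_add_one_self[of "2 * B\<^sup>2 * ?e"] by linarith
      show "0 \<le> a 1 + 2 * B\<^sup>2 * ?e" using a[of 1] K(1) by simp
    qed
    also have "exp (2 * B\<^sup>2 * ?e) ^ i = exp (real i * (2 * B\<^sup>2 * ?e))" by (rule exp_of_nat_mult[symmetric])
    also have "real i * (2 * B\<^sup>2 * ?e) \<le> 2 * B\<^sup>2 * K"
    proof -
      have "real i / real (Suc i) * (2 * B\<^sup>2 * K) \<le> 1 * (2 * B\<^sup>2 * K)"
        using K(1) by (intro mult_right_mono) auto
      then show ?thesis by (simp add: mult_ac)
    qed
    finally show ?thesis using M[of i] by (simp add: divide_right_mono)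
  qed
  obtain C where C: "C \<ge> 0"
    "\<And>i N. (\<Sum>n\<le>N. bell a n i / M n) \<le> C * (a 1 + 2 * B\<^sup>2 * (1 / (2 * B))) ^ i / M i"
    using bell_sum_le_algebra_sequence[OF alg na a aB B, of "1 / (2 * B)"] B by auto
  \<comment> \<open>From \<open>i0\<close> on, \<open>B * (K / (i+1)) \<le> 1/2\<close>.\<close>
  obtain i0 :: nat where i0: "2 * B * K \<le> real i0" using real_arch_simple by blast
  let ?T = "a 1 + 2 * B\<^sup>2 * (1 / (2 * B))"
  have T: "0 \<le> ?T" using a[of 1] B by simp
  let ?C = "exp (2 * B\<^sup>2 * K) + C * (1 + ?T) ^ i0"
  have "(\<Sum>n\<le>N. bell a n i / M n) \<le> ?C / M i" for i N
  proof (cases "i \<le> i0")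
    case True
    have "?T ^ i \<le> (1 + ?T) ^ i" using T by (intro power_mono) auto
    also have "\<dots> \<le> (1 + ?T) ^ i0" using T True by (intro power_increasing) auto
    finally have "C * ?T ^ i \<le> C * (1 + ?T) ^ i0" using C(1) by (rule mult_left_mono)
    also have "\<dots> \<le> ?C" by simp
    finally have "C * ?T ^ i \<le> ?C" .
    then have "C * ?T ^ i / M i \<le> ?C / M i" using M[of i] by (intro divide_right_mono) auto
    then show ?thesis using C(2)[of i N] by linarith
  next
    case False
    then have "2 * B * K \<le> real (Suc i)" using i0 by simp
    then have "B * (K / real (Suc i)) \<le> 1/2" by (simp add: divide_le_eq)
    from large[OF this, of N] have "(\<Sum>n\<le>N. bell a n i / M n) \<le> exp (2 * B\<^sup>2 * K) / M i" .
    also have "\<dots> \<le> ?C / M i" using M[of i] C(1) T by (intro divide_right_mono) auto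
    finally show ?thesis .
  qed
  moreover have "?C \<ge> 0" using C(1) T by simp
  ultimately show ?thesis by blast
qed

lemma limsup_root_finite_bound:
  fixes y :: "nat \<Rightarrow> real"
  assumes y: "\<And>k. y k \<ge> 0" and lim: "limsup (\<lambda>k. ereal (root k (y k))) < \<infinity>"
  shows "\<exists>B>0. \<forall>k\<ge>1. y k \<le> B ^ k"
proof -
  obtain C :: nat where "limsup (\<lambda>k. ereal (root k (y k))) < ereal (real C)"
    using less_PInf_Ex_of_nat lim by auto
  then have "\<forall>\<^sub>F k in sequentially. ereal (root k (y k)) < ereal (real C)"
    by (rule Limsup_lessD)
  then obtain k0 where k0: "\<And>k. k \<ge> k0 \<Longrightarrow> root k (y k) < real C"
    unfolding eventually_sequentially by auto
  define S where "S = (\<Sum>k\<le>k0. y k)"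
  have S: "S \<ge> 0" unfolding S_def using y by (intro sum_nonneg) auto
  have "y k \<le> (1 + real C + S) ^ k" if k: "k \<ge> 1" for k
  proof (cases "k \<le> k0")
    case True
    have "y k \<le> S" unfolding S_def using y True by (intro member_le_sum) auto
    also have "\<dots> \<le> (1 + real C + S) ^ 1" by simp
    also have "\<dots> \<le> (1 + real C + S) ^ k" using k S by (intro power_increasing) auto
    finally show ?thesis .
  next
    case False
    have "y k = root k (y k) ^ k" using k y by (simp add: real_root_pow_pos2)
    also have "\<dots> \<le> (1 + real C + S) ^ k" using k0[of k] False y S by (intro power_mono) auto
    finally show ?thesis .
  qed
  then show ?thesis using S by (intro exI[of _ "1 + real C + S"]) auto
qed


section \<open>Norm estimates for composites\<close>

lemma sup_norm_upper:
  assumes "compact X" "continuous_on X f" "x \<in> X"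
  shows "cmod (f x) \<le> sup_norm X f"
proof -
  have "compact ((\<lambda>x. cmod (f x)) ` X)"
    using assms by (intro compact_continuous_image continuous_intros) auto
  then have "bdd_above ((\<lambda>x. cmod (f x)) ` X)" by (intro bounded_imp_bdd_above compact_imp_bounded)
  then show ?thesis unfolding sup_norm_def using assms(3) by (rule cSUP_upper[rotated])
qed

lemma sup_norm_nonneg:
  assumes "compact X" "continuous_on X f" "X \<noteq> {}"
  shows "0 \<le> sup_norm X f"
proof -
  obtain x where "x \<in> X" using assms(3) by blast
  from sup_norm_upper[OF assms(1,2) this] show ?thesis using norm_ge_zero order_trans by blast
qed

lemma sup_norm_least: "X \<noteq> {} \<Longrightarrow> (\<And>x. x \<in> X \<Longrightarrow> cmod (f x) \<le> B) \<Longrightarrow> sup_norm X f \<le> B"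
  unfolding sup_norm_def by (rule cSUP_least)

lemma sup_norm_restrict: "sup_norm X (restrict f X) = sup_norm X f"
  unfolding sup_norm_def by (rule SUP_cong) auto

text \<open>
  The triangle inequality turns the recursion of \<^const>\<open>comp_deriv\<close> into that of \<^const>\<open>bell\<close>.
\<close>

lemma comp_deriv_bound:
  assumes f: "\<And>j. cmod (f j (\<phi> 0 x)) \<le> N j" and \<phi>: "\<And>k. cmod (\<phi> k x) \<le> a k"
  shows "cmod (comp_deriv f \<phi> n i x) \<le> (\<Sum>j\<le>n. N (i + j) * bell a n j)"
proof (induction n arbitrary: i rule: less_induct)
  case (less n)
  have N: "N j \<ge> 0" for j using f[of j] norm_ge_zero order_trans by blast
  have a: "a k \<ge> 0" for k using \<phi>[of k] norm_ge_zero order_trans by blast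
  show ?case
  proof (cases n)
    case 0
    then show ?thesis using f[of i] by (simp add: bell_0)
  next
    case (Suc m)
    have "cmod (comp_deriv f \<phi> n i x)
        \<le> (\<Sum>k\<le>m. real (m choose k) * ((\<Sum>j\<le>m. N (Suc i + j) * bell a k j) * a (Suc (m - k))))"
      unfolding Suc comp_deriv.simps
    proof (rule sum_norm_le)
      fix k assume k: "k \<in> {..m}"
      have "cmod (comp_deriv f \<phi> k (Suc i) x) \<le> (\<Sum>j\<le>k. N (Suc i + j) * bell a k j)"
        using less.IH[of k "Suc i"] k Suc by simp
      also have "\<dots> \<le> (\<Sum>j\<le>m. N (Suc i + j) * bell a k j)"
        using k N bell_nonneg[OF a] by (intro sum_mono2) auto
      finally have "cmod (comp_deriv f \<phi> k (Suc i) x) * cmod (\<phi> (Suc (m - k)) x)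
          \<le> (\<Sum>j\<le>m. N (Suc i + j) * bell a k j) * a (Suc (m - k))"
        using N bell_nonneg[OF a] by (intro mult_mono \<phi> sum_nonneg) auto
      then show "cmod (of_nat (m choose k) * (comp_deriv f \<phi> k (Suc i) x * \<phi> (Suc (m - k)) x))
          \<le> real (m choose k) * ((\<Sum>j\<le>m. N (Suc i + j) * bell a k j) * a (Suc (m - k)))"
        by (simp add: norm_mult mult_left_mono)
    qed
    also have "\<dots> = (\<Sum>k\<le>m. \<Sum>j\<le>m. N (Suc i + j) * (real (m choose k) * (bell a k j * a (Suc (m - k)))))"
      by (simp add: sum_distrib_left sum_distrib_right mult_ac)
    also have "\<dots> = (\<Sum>j\<le>m. \<Sum>k\<le>m. N (Suc i + j) * (real (m choose k) * (bell a k j * a (Suc (m - k)))))"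
      by (rule sum.swap)
    also have "\<dots> = (\<Sum>j\<le>m. N (Suc i + j) * bell a (Suc m) (Suc j))"
      by (simp only: bell_Suc sum_distrib_left)
    also have "\<dots> = (\<Sum>j\<le>n. N (i + j) * bell a n j)"
      unfolding Suc by (subst sum.atMost_Suc_shift) (simp add: bell_0)
    finally show ?thesis .
  qed
qed

text \<open>
  Interchanging the sums over \<open>n\<close> and \<open>j\<close> bounds the norm of \<open>f \<circ> \<phi>\<close> by \<open>C\<close> times the norm of \<open>f\<close>.
\<close>

lemma compose_in_DM:
  assumes X: "compact X" "X \<noteq> {}" and Y: "compact Y" "Y \<noteq> {}"
    and eff: "effective X \<F>" and effG: "effective Y \<G>"
    and \<phi>: "\<phi> \<in> Dinf X \<F>" and comp: "compatible X \<F> Y \<G> \<phi>"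
    and M: "\<And>n. M n > 0"
    and C: "\<And>i N. (\<Sum>n\<le>N. bell (\<lambda>k. sup_norm X (F_higher_deriv X \<F> k \<phi>)) n i / M n) \<le> C / M i"
    and f: "f \<in> DM Y \<G> M"
  shows "compose X f \<phi> \<in> DM X \<F> M"
proof -
  define fs where "fs i = F_higher_deriv Y \<G> i f" for i
  define \<phi>s where "\<phi>s i = F_higher_deriv X \<F> i \<phi>" for i
  define N where "N i = sup_norm Y (fs i)" for i
  define a where "a i = sup_norm X (\<phi>s i)" for i
  have clX: "closed X" and clY: "closed Y" using X Y compact_imp_closed by auto
  have fD: "f \<in> Dinf Y \<G>" and fsum: "summable (\<lambda>j. N j / M j)"
    using f unfolding DM_def N_def fs_def by auto
  have dphi: "derivative_on X \<F> (\<phi>s j) (\<phi>s (Suc j))" for j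
    unfolding \<phi>s_def by (rule Dinf_derivative_on[OF eff clX \<phi>])
  have \<phi>01: "\<phi>s 0 = \<phi>" "\<phi>s 1 = F_deriv X \<F> \<phi>" by (simp_all add: \<phi>s_def F_higher_deriv_def)
  have df: "derivative_on X \<F> (\<lambda>x. fs i (\<phi>s 0 x)) (\<lambda>x. fs (Suc i) (\<phi>s 0 x) * \<phi>s 1 x)" for i
  proof -
    have "fs i \<in> F_differentiable Y \<G>" using fD unfolding Dinf_iff fs_def by blast
    moreover have "fs (Suc i) = F_deriv Y \<G> (fs i)" by (simp add: fs_def F_higher_deriv_def)
    ultimately show ?thesis
      unfolding \<phi>01 using derivative_on_compose[OF eff clX clY effG comp] by simp
  qed
  let ?H = "\<lambda>n. comp_deriv fs \<phi>s n 0"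
  have dH: "derivative_on X \<F> (?H n) (?H (Suc n))" for n
    by (rule derivative_on_comp_deriv[where f = fs and \<phi> = \<phi>s, OF eff df dphi])
  have f0: "compose X f \<phi> = restrict (?H 0) X"
    by (auto simp: compose_def fs_def F_higher_deriv_def \<phi>01 fun_eq_iff)
  note chain = derivative_chain_Dinf[OF eff clX, of ?H, OF dH, folded f0]
  have \<phi>cont: "continuous_on X (\<phi>s j)" for j using dphi[of j] unfolding derivative_on_def by blast
  have fcont: "continuous_on Y (fs j)" for j
    using Dinf_derivative_on[OF effG clY fD, of j] unfolding derivative_on_def fs_def by blast
  have N0: "N j \<ge> 0" for j unfolding N_def by (rule sup_norm_nonneg[OF Y(1) fcont Y(2)])
  have a0: "a k \<ge> 0" for k unfolding a_def by (rule sup_norm_nonneg[OF X(1) \<phi>cont X(2)])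
  have Hcont: "continuous_on X (?H n)" for n using dH[of n] unfolding derivative_on_def by blast
  have norm: "sup_norm X (F_higher_deriv X \<F> n (compose X f \<phi>)) \<le> (\<Sum>j\<le>n. N j * bell a n j)" for n
    unfolding chain sup_norm_restrict
  proof (rule sup_norm_least[OF X(2)])
    fix x assume x: "x \<in> X"
    have "\<phi> x \<in> Y" using comp x unfolding compatible_def by blast
    then have "cmod (fs j (\<phi>s 0 x)) \<le> N j" for j
      unfolding N_def \<phi>01 by (rule sup_norm_upper[OF Y(1) fcont])
    moreover have "cmod (\<phi>s k x) \<le> a k" for k
      unfolding a_def by (rule sup_norm_upper[OF X(1) \<phi>cont x])
    ultimately show "cmod (?H n x) \<le> (\<Sum>j\<le>n. N j * bell a n j)"
      using comp_deriv_bound[of fs \<phi>s x N a n 0] by simp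
  qed
  have norm0: "0 \<le> sup_norm X (F_higher_deriv X \<F> n (compose X f \<phi>))" for n
    unfolding chain sup_norm_restrict by (rule sup_norm_nonneg[OF X(1) Hcont X(2)])
  have C0: "0 \<le> C"
  proof -
    have "bell a 0 0 / M 0 \<le> C / M 0" using C[of 0 0] unfolding a_def \<phi>s_def by simp
    then show ?thesis using M[of 0] by (simp add: bell_0 divide_right_mono field_simps)
  qed
  have "summable (\<lambda>n. sup_norm X (F_higher_deriv X \<F> n (compose X f \<phi>)) / M n)"
  proof (rule summableI_nonneg_bounded)
    fix n
    show "0 \<le> sup_norm X (F_higher_deriv X \<F> n (compose X f \<phi>)) / M n"
      using norm0 M[of n] by simp
    have "(\<Sum>m<n. sup_norm X (F_higher_deriv X \<F> m (compose X f \<phi>)) / M m)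
        \<le> (\<Sum>m<n. \<Sum>j\<le>n. N j * (bell a m j / M m))"
    proof (rule sum_mono)
      fix m assume m: "m \<in> {..<n}"
      have "sup_norm X (F_higher_deriv X \<F> m (compose X f \<phi>)) / M m \<le> (\<Sum>j\<le>m. N j * bell a m j) / M m"
        using norm[of m] M[of m] by (simp add: divide_right_mono)
      also have "\<dots> = (\<Sum>j\<le>m. N j * (bell a m j / M m))" by (simp add: sum_divide_distrib)
      also have "\<dots> \<le> (\<Sum>j\<le>n. N j * (bell a m j / M m))"
        using m N0 bell_nonneg[OF a0] M[of m] by (intro sum_mono2) auto
      finally show "sup_norm X (F_higher_deriv X \<F> m (compose X f \<phi>)) / M m
        \<le> (\<Sum>j\<le>n. N j * (bell a m j / M m))" .
    qed
    also have "\<dots> = (\<Sum>j\<le>n. N j * (\<Sum>m<n. bell a m j / M m))"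
      by (subst sum.swap) (simp add: sum_distrib_left)
    also have "\<dots> \<le> (\<Sum>j\<le>n. N j * (C / M j))"
    proof (intro sum_mono mult_left_mono N0)
      fix j
      have "(\<Sum>m<n. bell a m j / M m) \<le> (\<Sum>m\<le>n. bell a m j / M m)"
        using bell_nonneg[OF a0] M by (intro sum_mono2) (auto simp: less_imp_le)
      also have "\<dots> \<le> C / M j" using C[where i = j and N = n] unfolding a_def \<phi>s_def .
      finally show "(\<Sum>m<n. bell a m j / M m) \<le> C / M j" .
    qed
    also have "\<dots> = C * (\<Sum>j\<le>n. N j / M j)" by (simp add: sum_distrib_left mult_ac)
    also have "\<dots> \<le> C * (\<Sum>j. N j / M j)"
      using C0 N0 M by (intro mult_left_mono sum_le_suminf fsum) (auto simp: less_imp_le)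
    finally show "(\<Sum>m<n. sup_norm X (F_higher_deriv X \<F> m (compose X f \<phi>)) / M m)
        \<le> C * (\<Sum>j. N j / M j)" .
  qed
  then show ?thesis using chain(2) unfolding DM_def by blast
qed

lemma induces_homomorphismI:
  assumes "\<phi> ` X \<subseteq> Y" and "\<And>f. f \<in> DM Y \<G> M \<Longrightarrow> compose X f \<phi> \<in> DM X \<F> M"
  shows "induces_homomorphism X \<F> Y \<G> M \<phi>"
  unfolding induces_homomorphism_def algebra_homomorphism_def
  using assms by (auto simp: compose_def fun_eq_iff image_subset_iff)

theorem theorem5p4:
  fixes X Y :: "complex set" and \<F> \<G> :: "plane_path set"
    and \<phi> :: "complex \<Rightarrow> complex" and M :: "nat \<Rightarrow> real"
  assumes "compact_plane_set X" and "semi_rectifiable X"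
    and "compact_plane_set Y" and "semi_rectifiable Y"
    and "effective X \<F>" and "effective Y \<G>"
    and "\<phi> \<in> Dinf X \<F>" and "\<phi> ` X \<subseteq> Y"
    and "F_analytic X \<F> \<phi>" and "compatible X \<F> Y \<G> \<phi>"
    and "algebra_sequence M" and "nonanalytic M"
  shows "(sup_norm X (F_deriv X \<F> \<phi>) < 1 \<longrightarrow> induces_homomorphism X \<F> Y \<G> M \<phi>)
    \<and> (bounded ((\<lambda>n. (real n)\<^sup>2 * M (n - 1) / M n) ` {1..})
        \<and> sup_norm X (F_deriv X \<F> \<phi>) \<le> 1 \<longrightarrow> induces_homomorphism X \<F> Y \<G> M \<phi>)"
proof -
  have X: "compact X" "X \<noteq> {}" "closed X" and Y: "compact Y" "Y \<noteq> {}"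
    using assms(1,3) compact_imp_closed unfolding compact_plane_set_def by auto
  have M: "M n > 0" for n using assms(11) unfolding algebra_sequence_def by blast
  define a where "a k = sup_norm X (F_higher_deriv X \<F> k \<phi>)" for k
  have a1: "a 1 = sup_norm X (F_deriv X \<F> \<phi>)" by (simp add: a_def F_higher_deriv_def)
  have a0: "a k \<ge> 0" for k
    using Dinf_derivative_on[OF assms(5) X(3) assms(7), of k] X
    unfolding a_def derivative_on_def by (intro sup_norm_nonneg) auto
  have "\<exists>B>0. \<forall>k\<ge>1. a k / fact k \<le> B ^ k"
    using assms(9) a0 unfolding F_analytic_def a_def by (intro limsup_root_finite_bound) auto
  then obtain B where B: "B > 0" and aB: "\<And>k. k \<ge> 1 \<Longrightarrow> a k \<le> fact k * B ^ k"
    by (auto simp: divide_le_eq mult.commute)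
  have hom: "induces_homomorphism X \<F> Y \<G> M \<phi>"
    if ex: "\<exists>C\<ge>0. \<forall>i N. (\<Sum>n\<le>N. bell a n i / M n) \<le> C / M i"
  proof -
    obtain C where "\<And>i N. (\<Sum>n\<le>N. bell a n i / M n) \<le> C / M i" using ex by blast
    then have "\<And>i N. (\<Sum>n\<le>N. bell (\<lambda>k. sup_norm X (F_higher_deriv X \<F> k \<phi>)) n i / M n) \<le> C / M i"
      unfolding a_def by blast
    from compose_in_DM[OF X(1,2) Y assms(5,6,7,10) M this]
    show ?thesis by (intro induces_homomorphismI assms(8)) auto
  qed
  have "induces_homomorphism X \<F> Y \<G> M \<phi>" if "sup_norm X (F_deriv X \<F> \<phi>) < 1"
    using that a1 by (intro hom bell_sum_le_contraction[OF assms(11,12) a0 aB B]) auto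
  moreover have "induces_homomorphism X \<F> Y \<G> M \<phi>"
    if bdd: "bounded ((\<lambda>n. (real n)\<^sup>2 * M (n - 1) / M n) ` {1..})" and le: "sup_norm X (F_deriv X \<F> \<phi>) \<le> 1"
  proof -
    obtain K where K: "K > 0" "\<forall>x\<in>(\<lambda>n. (real n)\<^sup>2 * M (n - 1) / M n) ` {1..}. norm x \<le> K"
      using bdd unfolding bounded_pos by blast
    have "(real n)\<^sup>2 * M (n - 1) / M n \<le> K" if n: "n \<ge> 1" for n
    proof -
      have "\<bar>(real n)\<^sup>2 * M (n - 1) / M n\<bar> \<le> K" using K(2) n by fastforce
      then show ?thesis by linarith
    qed
    with le a1 K(1) show ?thesis
      by (intro hom bell_sum_le_quadratic_growth[OF assms(11,12) a0 aB B]) auto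
  qed
  ultimately show ?thesis by blast
qed

end
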